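(* Let $\gamma_1,\gamma_2$ be the instantaneous SNRs of the RF and optical hops described in the context, $\kappa_1,\kappa_2\ge0$, and let $$\gamma=\frac{\gamma_1\gamma_2}{\delta\,\gamma_1\gamma_2+(1+\kappa_2^2)\gamma_2+C},\qquad \delta=\kappa_1^2+\kappa_2^2+\kappa_1^2\kappa_2^2,\qquad C=\mathbb{E}[\gamma_1](1+\kappa_1^2)+1,$$ be the end-to-end signal-to-noise-plus-distortion ratio of amplify-and-forward relaying. For $\gamma_{\mathrm{th}}>0$, the outage probability $P_{\mathrm{out}}(\gamma_{\mathrm{th}})=\Pr[\gamma\le\gamma_{\mathrm{th}}]$ satisfies: if $1-\delta\gamma_{\mathrm{th}}>0$, then $$P_{\mathrm{out}}(\gamma_{\mathrm{th}})=1-\frac{m\xi^2A}{2^r(2\pi)^{r-1}}\binom{M}{m}\sum_{k=0}^{m-1}\sum_{n=1}^{\beta}\binom{m-1}{k}e^{-\zeta_1\frac{\gamma_{\mathrm{th}}}{\mu_1}}\frac{(-1)^kb_n\,r^{\alpha+n-1}}{M-m+k+1}\,G_{r,3r+1}^{3r+1,0}\left(\zeta_2\frac{\gamma_{\mathrm{th}}}{\mu_1\mu_r}\;\middle|\;\begin{matrix}\tau_5\\ \tau_4\end{matrix}\right),$$ where $\tau_5=\Delta(r:\xi^2+1)$, $\tau_4=[\Delta(r:\xi^2),\Delta(r:\alpha),\Delta(r:n),0]$ and $$\zeta_1=\frac{(M-m+k+1)(1+\kappa_2^2)}{[(M-m+k)(1-\rho_m)+1](1-\delta\gamma_{\mathrm{th}})},\qquad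 \zeta_2=\frac{(M-m+k+1)\,C}{[(M-m+k)(1-\rho_m)+1](1-\delta\gamma_{\mathrm{th}})}\left(\frac{B}{r^2}\right)^r$$ (both depending on $k$); otherwise $P_{\mathrm{out}}(\gamma_{\mathrm{th}})=1$.
   Context: Notation. $\Delta(j:x)$ denotes the list $\frac{x}{j},\frac{x+1}{j},\dots,\frac{x+j-1}{j}$. $G_{p,q}^{m,n}\left(z\,\middle|\,\begin{matrix}a_1,\dots,a_p\\ b_1,\dots,b_q\end{matrix}\right)$ is the Meijer G-function with the standard convention $\frac{1}{2\pi i}\int \frac{\prod_{j=1}^m\Gamma(b_j+s)\prod_{j=1}^n\Gamma(1-a_j-s)}{\prod_{j=m+1}^q\Gamma(1-b_j-s)\prod_{j=n+1}^p\Gamma(a_j+s)}z^{-s}ds$, the contour separating the poles of the $\Gamma(b_j+s)$ from those of the $\Gamma(1-a_j-s)$. RF hop. $M\ge1$ is the number of relays, $1\le m\le M$ the rank of the selected relay, $\rho_m\in[0,1]$ the time correlation coefficient between outdated and actual CSI, $\mu_1>0$ the average SNR of the first hop. $\gamma_1$ is a nonnegative random variable with density, for $x\ge0$, $$f_{\gamma_1}(x)=m\binom{M}{m}\sum_{k=0}^{m-1}\frac{(-1)^k\binom{m-1}{k}}{[(M-m+k)(1-\rho_m)+1]\mu_1}\exp\left(-\frac{(M-m+k+1)x}{[(M-m+k)(1-\rho_m)+1]\mu_1}\right),$$ so that $\mathbb{E}[\gamma_1]=m\binom{M}{m}\sum_{k=0}^{m-1}\binom{m-1}{k}(-1)^k\frac{[(M-m+k)(1-\rho_m)+1]\mu_1}{(M-m+k+1)^2}$.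 Optical hop. $r\in\{1,2\}$ is the detection type, $\mu_r>0$ the average electrical SNR, $\xi>0$ the pointing error coefficient, $\alpha>0$, $\beta$ a positive integer, $g>0$, $\Omega'>0$ the Málaga turbulence parameters, $B>0$ a constant of the fading law. Put $$A=\frac{2\alpha^{\alpha/2}}{g^{1+\alpha/2}\Gamma(\alpha)}\left(\frac{g\beta}{g\beta+\Omega'}\right)^{\beta+\alpha/2},\quad a_n=\binom{\beta-1}{n-1}\frac{(g\beta+\Omega')^{1-n/2}}{(n-1)!}\left(\frac{\Omega'}{g}\right)^{n-1}\left(\frac{\alpha}{\beta}\right)^{n/2},\quad b_n=a_n\left(\frac{g\beta+\Omega'}{\alpha\beta}\right)^{\frac{\alpha+n}{2}}.$$ $\gamma_2$ is a positive random variable, independent of $\gamma_1$, with density for $x>0$ $$f_{\gamma_2}(x)=\frac{\xi^2A}{2^r x}\sum_{n=1}^{\beta}b_n\,G_{1,3}^{3,0}\left(B\left(\frac{x}{\mu_r}\right)^{1/r}\;\middle|\;\begin{matrix}\xi^2+1\\ \xi^2,\ \alpha,\ n\end{matrix}\right).$$ *)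

theory Defs
  imports "HOL-Probability.Probability" "HOL-Complex_Analysis.Complex_Analysis"
begin

text \<open>
  Meijer G-function. The parameters \<open>a\<^sub>1, \<dots>, a\<^sub>p\<close> and \<open>b\<^sub>1, \<dots>, b\<^sub>q\<close> are given as
  lists, so that \<open>p\<close> and \<open>q\<close> are their lengths; the power of \<open>z\<close> is the principal one.
\<close>

definition meijer_integrand ::
    "nat \<Rightarrow> nat \<Rightarrow> complex list \<Rightarrow> complex list \<Rightarrow> complex \<Rightarrow> complex \<Rightarrow> complex" where
  "meijer_integrand m n as bs z s =
     ((\<Prod>b\<leftarrow>take m bs. Gamma (b + s)) * (\<Prod>a\<leftarrow>take n as. Gamma (1 - a - s))) /
     ((\<Prod>b\<leftarrow>drop m bs. Gamma (1 - b - s)) * (\<Prod>a\<leftarrow>drop n as. Gamma (a + s))) * z powr (- s)"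

definition meijer_left_poles :: "nat \<Rightarrow> complex list \<Rightarrow> complex set" where
  "meijer_left_poles m bs = {s. \<exists>b\<in>set (take m bs). b + s \<in> nonpos_Ints}"

definition meijer_right_poles :: "nat \<Rightarrow> complex list \<Rightarrow> complex set" where
  "meijer_right_poles n as = {s. \<exists>a\<in>set (take n as). 1 - a - s \<in> nonpos_Ints}"

text \<open>
  A contour from \<open>-\<i>\<infinity>\<close> to \<open>+\<i>\<infinity>\<close> is a curve \<open>L :: real \<Rightarrow> complex\<close> that is piecewise \<open>C\<^sup>1\<close> on
  bounded intervals and runs up a vertical line outside a bounded interval. Seen from a point
  \<open>p\<close> off the curve, the direction of \<open>L t\<close> turns from \<open>-\<pi>/2\<close> to \<open>\<pi>/2\<close>, a half turn
  counterclockwise, if \<open>p\<close> lies to the left of the curve, and makes a half turn clockwise if \<open>p\<close>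
  lies to its right. Hence the limits \<open>1/2\<close> and \<open>-1/2\<close> of the winding numbers below.
\<close>

definition vertical_contour :: "(real \<Rightarrow> complex) \<Rightarrow> bool" where
  "vertical_contour L \<longleftrightarrow>
     (\<forall>R>0. valid_path (L \<circ> linepath (- R) R)) \<and>
     (\<exists>c T. \<forall>t. \<bar>t\<bar> \<ge> T \<longrightarrow> L t = Complex c t)"

definition left_of_contour :: "complex \<Rightarrow> (real \<Rightarrow> complex) \<Rightarrow> bool" where
  "left_of_contour p L \<longleftrightarrow>
     p \<notin> range L \<and> ((\<lambda>R. winding_number (L \<circ> linepath (- R) R) p) \<longlongrightarrow> 1 / 2) at_top"

definition right_of_contour :: "complex \<Rightarrow> (real \<Rightarrow> complex) \<Rightarrow> bool" where
  "right_of_contour p L \<longleftrightarrow>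
     p \<notin> range L \<and> ((\<lambda>R. winding_number (L \<circ> linepath (- R) R) p) \<longlongrightarrow> - 1 / 2) at_top"

definition meijer_contour ::
    "nat \<Rightarrow> nat \<Rightarrow> complex list \<Rightarrow> complex list \<Rightarrow> (real \<Rightarrow> complex) \<Rightarrow> bool" where
  "meijer_contour m n as bs L \<longleftrightarrow>
     vertical_contour L \<and>
     (\<forall>p\<in>meijer_left_poles m bs. left_of_contour p L) \<and>
     (\<forall>p\<in>meijer_right_poles n as. right_of_contour p L)"

definition meijer_G ::
    "nat \<Rightarrow> nat \<Rightarrow> complex list \<Rightarrow> complex list \<Rightarrow> complex \<Rightarrow> complex" where
  "meijer_G m n as bs z =
     (THE G. \<exists>L. meijer_contour m n as bs L \<and>
        ((\<lambda>R. 1 / (2 * of_real pi * \<i>) *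
              contour_integral (L \<circ> linepath (- R) R) (meijer_integrand m n as bs z))
          \<longlongrightarrow> G) at_top)"

definition Delta :: "nat \<Rightarrow> real \<Rightarrow> real list" where
  "Delta j x = map (\<lambda>i. (x + real i) / real j) [0..<j]"

text \<open>
  Since \<^const>\<open>ennreal\<close> sends negative reals to \<open>0\<close>, nonnegativity of a real density has to be
  required separately.
\<close>

definition has_density :: "'a measure \<Rightarrow> ('a \<Rightarrow> real) \<Rightarrow> (real \<Rightarrow> real) \<Rightarrow> bool" where
  "has_density P X f \<longleftrightarrow>
     distributed P lborel X (\<lambda>x. ennreal (f x)) \<and> (AE x in lborel. 0 \<le> f x)"

definition rf_density :: "nat \<Rightarrow> nat \<Rightarrow> real \<Rightarrow> real \<Rightarrow> real \<Rightarrow> real" where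
  "rf_density M m \<rho> \<mu>\<^sub>1 x =
     (if 0 \<le> x then
        real m * real (M choose m) *
        (\<Sum>k<m. (- 1) ^ k * real ((m - 1) choose k) / ((real (M - m + k) * (1 - \<rho>) + 1) * \<mu>\<^sub>1) *
           exp (- (real (M - m + k + 1) * x / ((real (M - m + k) * (1 - \<rho>) + 1) * \<mu>\<^sub>1))))
      else 0)"

definition malaga_A :: "real \<Rightarrow> nat \<Rightarrow> real \<Rightarrow> real \<Rightarrow> real" where
  "malaga_A \<alpha> \<beta> g \<Omega>' =
     2 * \<alpha> powr (\<alpha> / 2) / (g powr (1 + \<alpha> / 2) * Gamma \<alpha>) *
     (g * real \<beta> / (g * real \<beta> + \<Omega>')) powr (real \<beta> + \<alpha> / 2)"

definition malaga_a :: "real \<Rightarrow> nat \<Rightarrow> real \<Rightarrow> real \<Rightarrow> nat \<Rightarrow> real" where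
  "malaga_a \<alpha> \<beta> g \<Omega>' n =
     real ((\<beta> - 1) choose (n - 1)) * (g * real \<beta> + \<Omega>') powr (1 - real n / 2) / fact (n - 1) *
     (\<Omega>' / g) ^ (n - 1) * (\<alpha> / real \<beta>) powr (real n / 2)"

definition malaga_b :: "real \<Rightarrow> nat \<Rightarrow> real \<Rightarrow> real \<Rightarrow> nat \<Rightarrow> real" where
  "malaga_b \<alpha> \<beta> g \<Omega>' n =
     malaga_a \<alpha> \<beta> g \<Omega>' n *
     ((g * real \<beta> + \<Omega>') / (\<alpha> * real \<beta>)) powr ((\<alpha> + real n) / 2)"

text \<open>
  The G-function below has real parameters and a positive argument, so it is real and taking the
  real part only changes the type.
\<close>

definition optical_density ::
    "nat \<Rightarrow> real \<Rightarrow> real \<Rightarrow> real \<Rightarrow> nat \<Rightarrow> real \<Rightarrow> real \<Rightarrow> real \<Rightarrow> real \<Rightarrow> real" where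
  "optical_density r \<mu>\<^sub>r \<xi> \<alpha> \<beta> g \<Omega>' B x =
     (if 0 < x then
        \<xi>\<^sup>2 * malaga_A \<alpha> \<beta> g \<Omega>' / (2 ^ r * x) *
        (\<Sum>n=1..\<beta>. malaga_b \<alpha> \<beta> g \<Omega>' n *
           Re (meijer_G 3 0
                 (map complex_of_real [\<xi>\<^sup>2 + 1])
                 (map complex_of_real [\<xi>\<^sup>2, \<alpha>, real n])
                 (complex_of_real (B * (x / \<mu>\<^sub>r) powr (1 / real r)))))
      else 0)"

end

theory Submission
  imports Defs "HOL-Real_Asymp.Real_Asymp"
begin

text \<open>
  The event \<open>\<gamma> \<le> \<gamma>\<^sub>t\<^sub>h\<close> is the complement of
  \<open>\<gamma>\<^sub>1 > \<gamma>\<^sub>t\<^sub>h / (1 - \<delta> \<gamma>\<^sub>t\<^sub>h) (1 + \<kappa>\<^sub>2\<^sup>2 + C / \<gamma>\<^sub>2)\<close>. The tail of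
  \<open>\<gamma>\<^sub>1\<close> is a sum of exponentials, so by independence only the expectations of
  \<open>exp (- c / \<gamma>\<^sub>2)\<close> are needed. Inserting the Mellin-Barnes integral of the density of
  \<open>\<gamma>\<^sub>2\<close> and exchanging the integrals, the integral over \<open>x\<close> produces a factor
  \<open>\<Gamma>(s/r)\<close>; the substitution \<open>s = r w\<close> and the multiplication formula for \<open>\<Gamma>\<close>
  turn the result into the Mellin-Barnes integral on the right-hand side. Since the G-functions have
  no right poles and the integrand decays faster than any power on vertical strips, every
  admissible contour gives the same value as a vertical line to the right of the left poles.
\<close>

section \<open>Meijer G-functions as integrals along vertical lines\<close>

text \<open>\<open>meijer_G\<close> is a definite description over all admissible contours, so it
  has a usable value only once one contour is known to converge and every other convergent one is
  known to agree with it. This obstacle shapes the first section. The decay needed there is only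
  polynomial, so the functional equation of Gamma can replace Stirling's formula.

  The constants of the result come from the multiplication formula: \<open>Gamma (x + r w)\<close>
  equals \<open>(2 pi)^((1 - r)/2) r^(x + r w - 1/2)\<close> times the product of
  \<open>Gamma ((x + j)/r + w)\<close> over j < r. It is applied to three Gammas over one, with x =
  \<xi>^2, \<alpha>, n over \<xi>^2 + 1. What remains is \<open>(2 pi)^(1 - r)\<close>, the power
  \<open>r^(alpha + n - 2)\<close> and the factor \<open>r^(2 r w)\<close>. The Jacobian of
  \<open>s = r w\<close> raises the power to \<open>r^(alpha + n - 1)\<close>, and the last factor
  turns \<open>B^r\<close> into \<open>(B / r^2)^r\<close> inside \<open>\<zeta>\<^sub>2\<close>.
  The entry 0 of \<open>\<tau>\<^sub>4\<close> is the extra factor \<open>Gamma w\<close>. For r = 2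
  the formula is Legendre's duplication; for r = 1 it is trivial.\<close>

lemma norm_Gamma_le_Gamma_Re:
  assumes "0 < Re s"
  shows "norm (Gamma s) \<le> Gamma (Re s)"
proof -
  have "norm (integral {0..} (\<lambda>t. of_real t powr (s - 1) / of_real (exp t)))
      \<le> integral {0..} (\<lambda>t. t powr (Re s - 1) / exp t)"
  proof (rule integral_norm_bound_integral)
    show "(\<lambda>t. complex_of_real t powr (s - 1) / of_real (exp t)) integrable_on {0..}"
      using Gamma_integral_complex[OF assms] by blast
    show "(\<lambda>t. t powr (Re s - 1) / exp t) integrable_on {0..}"
      using Gamma_integral_real[OF assms] by blast
    show "norm (complex_of_real t powr (s - 1) / of_real (exp t)) \<le> t powr (Re s - 1) / exp t"
      if "t \<in> {0..}" for t
      using that by (auto simp: norm_divide norm_powr_real_powr)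
  qed
  then show ?thesis
    using Gamma_integral_complex[OF assms] Gamma_integral_real[OF assms]
    by (simp add: integral_unique)
qed

text \<open>Shifting by N gives \<open>Gamma s = Gamma (s + N) / pochhammer s N\<close>. The shifted
  Gamma is bounded because its real part stays in a compact positive interval, and each of the N
  factors of the Pochhammer symbol has modulus at least |Im s|.\<close>

lemma Gamma_bounded_on_strip:
  fixes a b :: real and k :: nat
  obtains K where "0 \<le> K"
    and "\<And>s. a \<le> Re s \<Longrightarrow> Re s \<le> b \<Longrightarrow> 1 \<le> \<bar>Im s\<bar> \<Longrightarrow> norm (Gamma s) \<le> K / \<bar>Im s\<bar> ^ k"
proof -
  \<comment> \<open>N supplies enough factors for order k and enough shift to move the strip into
    \<open>Re s >= 1\<close>.\<close>
  obtain N where N: "k \<le> N" "1 \<le> a + real N"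
  proof
    show "k \<le> k + nat \<lceil>1 - a\<rceil>" "1 \<le> a + real (k + nat \<lceil>1 - a\<rceil>)" by simp_all linarith
  qed
  have "continuous_on {a + real N..b + real N} (Gamma :: real \<Rightarrow> real)"
    using N by (intro continuous_on_Gamma) (auto dest: nonpos_Ints_nonpos)
  then have "bounded (Gamma ` {a + real N..b + real N})"
    by (intro compact_imp_bounded compact_continuous_image) auto
  then obtain K where K: "0 < K" "\<And>x. x \<in> {a + real N..b + real N} \<Longrightarrow> \<bar>Gamma x\<bar> \<le> K"
    by (auto simp: bounded_pos)
  show thesis
  proof (rule that[of K])
    fix s assume s: "a \<le> Re s" "Re s \<le> b" "1 \<le> \<bar>Im s\<bar>"
    have nz: "s \<notin> \<int>\<^sub>\<le>\<^sub>0" using s by (auto elim!: nonpos_Ints_cases)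
    have "\<bar>Im s\<bar> ^ k \<le> \<bar>Im s\<bar> ^ N" using s N by (intro power_increasing)
    also have "\<dots> = (\<Prod>i<N. \<bar>Im (s + of_nat i)\<bar>)" by simp
    also have "\<dots> \<le> (\<Prod>i<N. norm (s + of_nat i))"
      using abs_Im_le_cmod[of "s + of_nat _"] by (intro prod_mono conjI abs_ge_zero)
    also have "\<dots> = norm (pochhammer s N)"
      by (simp add: pochhammer_prod prod_norm atLeast0LessThan)
    finally have "\<bar>Im s\<bar> ^ k * norm (Gamma s) \<le> norm (pochhammer s N) * norm (Gamma s)"
      by (intro mult_right_mono) auto
    also have "\<dots> = norm (Gamma (s + of_nat N))"
      using nz by (simp add: pochhammer_Gamma norm_divide Gamma_eq_zero_iff)
    also have "\<dots> \<le> Gamma (Re (s + of_nat N))"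
      using s N by (intro norm_Gamma_le_Gamma_Re) auto
    also have "\<dots> \<le> K" using K(2)[of "Re (s + of_nat N)"] s by auto
    finally show "norm (Gamma s) \<le> K / \<bar>Im s\<bar> ^ k"
      using s by (simp add: field_simps)
  qed (use K in auto)
qed

section \<open>Deformation of contours\<close>

text \<open>The segment has fixed length |d - c| while the integrand on it is at most K / R. The
  sign \<sigma> selects the upper or the lower segment. The statement is used for the Meijer
  integrand and, with \<open>S = {p}\<close>, for the Cauchy kernel, where it controls winding
  numbers.\<close>

lemma tendsto_contour_integral_horizontal:
  fixes F :: "complex \<Rightarrow> complex"
  assumes F: "F holomorphic_on - S" and S: "S \<subseteq> \<real>"
    and decay: "\<And>a b. \<exists>K. \<forall>s. a \<le> Re s \<longrightarrow> Re s \<le> b \<longrightarrow> 1 \<le> \<bar>Im s\<bar> \<longrightarrow> norm (F s) \<le> K / \<bar>Im s\<bar>"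
    and \<sigma>: "\<bar>\<sigma>\<bar> = 1"
  shows "((\<lambda>R. contour_integral (linepath (Complex c (\<sigma> * R)) (Complex d (\<sigma> * R))) F) \<longlongrightarrow> 0) at_top"
proof -
  obtain K where K: "\<And>s. min c d \<le> Re s \<Longrightarrow> Re s \<le> max c d \<Longrightarrow> 1 \<le> \<bar>Im s\<bar> \<Longrightarrow> norm (F s) \<le> K / \<bar>Im s\<bar>"
    using decay[of "min c d" "max c d"] by blast
  show ?thesis
  proof (rule Lim_null_comparison)
    show "\<forall>\<^sub>F R in at_top. norm (contour_integral (linepath (Complex c (\<sigma> * R)) (Complex d (\<sigma> * R))) F)
        \<le> K / R * \<bar>d - c\<bar>"
      using eventually_ge_at_top[of 1]
    proof eventually_elim
      case (elim R)
      let ?l = "linepath (Complex c (\<sigma> * R)) (Complex d (\<sigma> * R))"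
      have seg: "Im w = \<sigma> * R \<and> min c d \<le> Re w \<and> Re w \<le> max c d"
        if w: "w \<in> closed_segment (Complex c (\<sigma> * R)) (Complex d (\<sigma> * R))" for w
      proof -
        have "Re w \<in> closed_segment c d"
          using w by (metis closed_segment_of_real complex.sel(1) in_closed_segment_imp_Re_in_closed_segment)
        moreover have "Im w = \<sigma> * R"
          using w by (metis (no_types, lifting) closed_segment_idem complex.sel(2) in_closed_segment_imp_Im_in_closed_segment singletonD)
        ultimately show ?thesis by (auto simp: closed_segment_eq_real_ivl split: if_splits)
      qed
      have "\<bar>Im w\<bar> = R" if "w \<in> closed_segment (Complex c (\<sigma> * R)) (Complex d (\<sigma> * R))" for w
        using seg[OF that] \<sigma> elim by (simp add: abs_mult)
      note Im = this
      have sub: "closed_segment (Complex c (\<sigma> * R)) (Complex d (\<sigma> * R)) \<subseteq> - S"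
      proof
        fix w assume "w \<in> closed_segment (Complex c (\<sigma> * R)) (Complex d (\<sigma> * R))"
        then show "w \<in> - S" using Im elim S complex_is_Real_iff by fastforce
      qed
      have "F contour_integrable_on ?l"
        by (intro contour_integrable_continuous_linepath holomorphic_on_imp_continuous_on
              holomorphic_on_subset[OF F sub])
      moreover have "norm (F w) \<le> K / R" if "w \<in> closed_segment (Complex c (\<sigma> * R)) (Complex d (\<sigma> * R))" for w
        using K[of w] seg[OF that] Im[OF that] elim by auto
      moreover have "0 \<le> K / R"
        using calculation(2)[of "Complex c (\<sigma> * R)"] by (meson ends_in_segment(1) norm_ge_zero order_trans)
      ultimately have "norm (contour_integral ?l F) \<le> K / R * norm (Complex d (\<sigma> * R) - Complex c (\<sigma> * R))"
        by (intro contour_integral_bound_linepath) auto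
      also have "Complex d (\<sigma> * R) - Complex c (\<sigma> * R) = of_real (d - c)"
        by (simp add: complex_eq_iff)
      finally show ?case by (simp only: norm_of_real)
    qed
    show "((\<lambda>R. K / R * \<bar>d - c\<bar>) \<longlongrightarrow> 0) at_top" by real_asymp
  qed
qed

text \<open>\<open>Ln (w - p)\<close> is a primitive of the Cauchy kernel on the half-plane to the
  right of p. As p is real, the end points seen from p are conjugate, so the difference of
  logarithms is 2i times the angle \<open>arctan (R / e)\<close>, where e is the distance from p to
  the line.\<close>

lemma winding_number_vertical_line:
  assumes "p \<in> \<real>" "Re p < d"
  shows "((\<lambda>R. winding_number (linepath (Complex d (- R)) (Complex d R)) p) \<longlongrightarrow> 1 / 2) at_top"
proof (rule Lim_transform_eventually)
  define e where "e = d - Re p"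
  have e: "e > 0" using assms by (simp add: e_def)
  have p: "p = of_real (Re p)" using assms by simp
  show "((\<lambda>R. of_real (arctan (R / e) / pi) :: complex) \<longlongrightarrow> 1 / 2) at_top"
  proof -
    have "((\<lambda>R. arctan (R / e)) \<longlongrightarrow> pi / 2) at_top"
      by (rule filterlim_compose[OF tendsto_arctan_at_top]) (use e in real_asymp)
    then have "((\<lambda>R. of_real (arctan (R / e) / pi) :: complex) \<longlongrightarrow> of_real (pi / 2 / pi)) at_top"
      by (intro tendsto_intros) auto
    then show ?thesis by simp
  qed
  show "\<forall>\<^sub>F R in at_top. of_real (arctan (R / e) / pi)
      = winding_number (linepath (Complex d (- R)) (Complex d R)) p"
    using eventually_gt_at_top[of 0]
  proof eventually_elim
    case (elim R)
    let ?l = "linepath (Complex d (- R)) (Complex d R)"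
    have "closed_segment (Complex d (- R)) (Complex d R) \<subseteq> {w. Re w = d}"
      by (intro closed_segment_subset) (auto simp: convex_alt algebra_simps)
    then have img: "path_image ?l \<subseteq> {w. Re w > Re p}"
      using assms by auto
    have "((\<lambda>w. 1 / (w - p)) has_contour_integral
        (Ln (pathfinish ?l - p) - Ln (pathstart ?l - p))) ?l"
    proof (rule contour_integral_primitive[where S = "{w. Re w > Re p}" and f = "\<lambda>w. Ln (w - p)"])
      fix x assume "x \<in> {w. Re w > Re p}"
      then have "x - p \<notin> \<real>\<^sub>\<le>\<^sub>0" by (auto simp: complex_nonpos_Reals_iff)
      then show "((\<lambda>w. Ln (w - p)) has_field_derivative 1 / (x - p)) (at x within {w. Re w > Re p})"
        by (auto intro!: derivative_eq_intros simp: inverse_eq_divide)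
    qed (use img in auto)
    then have "contour_integral ?l (\<lambda>w. 1 / (w - p)) = Ln (Complex d R - p) - Ln (Complex d (- R) - p)"
      by (simp add: contour_integral_unique)
    also have "Complex d (- R) - p = cnj (Complex e R)"
      by (subst p) (simp add: complex_eq_iff e_def)
    also have "Complex d R - p = Complex e R"
      by (subst p) (simp add: complex_eq_iff e_def)
    also have "Ln (cnj (Complex e R)) = cnj (Ln (Complex e R))"
      using e by (intro cnj_Ln[symmetric]) (simp add: complex_nonpos_Reals_iff)
    also have "Ln (Complex e R) - \<dots> = 2 * \<i> * of_real (Im (Ln (Complex e R)))"
      by (simp add: complex_eq_iff)
    also have "Im (Ln (Complex e R)) = arctan (R / e)"
      using e by (subst Im_Ln_eq) (auto simp: Complex_eq_0)
    finally show ?case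
      using img by (subst winding_number_valid_path) auto
  qed
qed

text \<open>
  Close \<open>L\<close> up by two horizontal segments and the line \<open>Re s = d\<close>. The winding number of this
  loop about a pole tends to \<open>1/2 - 1/2 = 0\<close> and is an integer, so it vanishes eventually. The loops
  stay in a fixed right half-plane, which contains only finitely many poles, so one \<open>R\<close> serves for
  all poles, and the global Cauchy theorem applies.
\<close>

lemma vertical_contour_deform:
  fixes F :: "complex \<Rightarrow> complex"
  assumes F: "F holomorphic_on - S" and "closed S" and real: "S \<subseteq> \<real>"
    and fin: "\<And>K. finite {p \<in> S. K \<le> Re p}"
    and decay: "\<And>a b. \<exists>K. \<forall>s. a \<le> Re s \<longrightarrow> Re s \<le> b \<longrightarrow> 1 \<le> \<bar>Im s\<bar> \<longrightarrow> norm (F s) \<le> K / \<bar>Im s\<bar>"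
    and L: "vertical_contour L" and left: "\<And>p. p \<in> S \<Longrightarrow> left_of_contour p L"
    and d: "\<And>p. p \<in> S \<Longrightarrow> Re p < d"
  shows "((\<lambda>R. contour_integral (L \<circ> linepath (- R) R) F
        - contour_integral (linepath (Complex d (- R)) (Complex d R)) F) \<longlongrightarrow> 0) at_top"
proof -
  obtain c T where cT: "\<And>t. T \<le> \<bar>t\<bar> \<Longrightarrow> L t = Complex c t"
    using L unfolding vertical_contour_def by blast
  define T' where "T' = max T 1"
  have valid: "valid_path (L \<circ> linepath (- R) R)" if "R > 0" for R
    using L that unfolding vertical_contour_def by blast
  have range: "path_image (L \<circ> linepath (- R) R) = L ` {- R..R}" if "R > 0" for R
    using that by (simp add: path_image_compose closed_segment_eq_real_ivl)
  \<comment> \<open>A common left bound for all loops: the middle part of L is compact, the tails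
    and the second line are vertical.\<close>
  obtain K where K: "K \<le> c" "K \<le> d" "\<And>t. K \<le> Re (L t)"
  proof -
    have "compact (L ` {- T'..T'})"
      using range[of T'] valid[of T'] compact_valid_path_image[of "L \<circ> linepath (- T') T'"] by (simp add: T'_def)
    then obtain B where B: "\<And>w. w \<in> L ` {- T'..T'} \<Longrightarrow> norm w \<le> B"
      using compact_imp_bounded bounded_iff by metis
    show thesis
    proof (rule that[of "min (- B) (min c d)"])
      fix t
      show "min (- B) (min c d) \<le> Re (L t)"
      proof (cases "T \<le> \<bar>t\<bar>")
        case True
        then show ?thesis using cT[of t] by simp
      next
        case False
        then have "norm (L t) \<le> B" by (intro B imageI) (auto simp: T'_def)
        then show ?thesis using abs_Re_le_cmod[of "L t"] by linarith
      qed
    qed auto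
  qed
  define h where "h \<sigma> R = linepath (Complex c (\<sigma> * R)) (Complex d (\<sigma> * R))" for \<sigma> R :: real
  define v where "v R = linepath (Complex d (- R)) (Complex d R)" for R
  define l where "l R = L \<circ> linepath (- R) R" for R
  \<comment> \<open>The loop goes up along L, across at height R, down the line
    \<open>Re s = d\<close>, and back at height -R.\<close>
  define g where "g R = l R +++ h 1 R +++ reversepath (v R) +++ reversepath (h (- 1) R)" for R
  have v_img: "path_image (v R) \<subseteq> {w. Re w = d}" for R
    unfolding v_def path_image_linepath
    by (intro closed_segment_subset) (auto simp: convex_alt algebra_simps)
  have h_img: "path_image (h \<sigma> R) \<subseteq> {w. Im w = \<sigma> * R} \<inter> {w. K \<le> Re w}" for \<sigma> R
    unfolding h_def path_image_linepath using K
    by (intro closed_segment_subset convex_Int convex_halfspace_Re_ge) (auto simp: convex_alt algebra_simps simp flip: distrib_right)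
  have v_S: "path_image (v R) \<inter> S = {}" for R
    using v_img d by fastforce
  have h_S: "path_image (h \<sigma> R) \<inter> S = {}" if "R > 0" "\<bar>\<sigma>\<bar> = 1" for R \<sigma>
    using h_img[of \<sigma> R] real that by (fastforce simp: complex_is_Real_iff)
  have l_S: "path_image (l R) \<inter> S = {}" if "R > 0" for R
    using left range[OF that] unfolding l_def left_of_contour_def by auto
  have ends: "pathstart (l R) = Complex c (- R)" "pathfinish (l R) = Complex c R" if "R > T'" for R
    using that cT[of R] cT[of "- R"]
    by (simp_all add: l_def pathstart_compose pathfinish_compose T'_def)
  have paths: "valid_path (v R)" "valid_path (h \<sigma> R)" for R \<sigma>
    by (auto simp: v_def h_def)
  have g: "valid_path (g R)" "pathfinish (g R) = pathstart (g R)" "path_image (g R) \<subseteq> - S"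
      "path_image (g R) \<subseteq> {w. K \<le> Re w}"
      "\<And>p. p \<in> S \<Longrightarrow> winding_number (g R) p = winding_number (l R) p + winding_number (h 1 R) p
         - winding_number (v R) p - winding_number (h (- 1) R) p"
      "contour_integral (g R) F = contour_integral (l R) F + contour_integral (h 1 R) F
         - contour_integral (v R) F - contour_integral (h (- 1) R) F" if R: "R > T'" for R
  proof -
    have R0: "R > 0" using R by (simp add: T'_def)
    have ends': "pathstart (h \<sigma> R) = Complex c (\<sigma> * R)" "pathfinish (h \<sigma> R) = Complex d (\<sigma> * R)"
       "pathstart (v R) = Complex d (- R)" "pathfinish (v R) = Complex d R" for \<sigma>
      by (simp_all add: h_def v_def)
    note ends'' = ends[OF R] ends'
    have vl: "valid_path (l R)" using valid[OF R0] by (simp add: l_def)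
    note S = v_S[of R] h_S[OF R0, of 1] h_S[OF R0, of "- 1"] l_S[OF R0]
    show "valid_path (g R)" "pathfinish (g R) = pathstart (g R)"
      unfolding g_def using paths vl by (auto simp: ends'')
    have img: "path_image (g R) = path_image (l R) \<union> path_image (h 1 R) \<union> path_image (v R) \<union> path_image (h (-1) R)"
      unfolding g_def using paths vl by (simp add: path_image_join ends'' Un_assoc)
    then show "path_image (g R) \<subseteq> - S" using S by auto
    show "path_image (g R) \<subseteq> {w. K \<le> Re w}"
      using img range[OF R0] v_img[of R] h_img K by (auto simp: l_def)
    show "winding_number (g R) p = winding_number (l R) p + winding_number (h 1 R) p
         - winding_number (v R) p - winding_number (h (- 1) R) p" if "p \<in> S" for p
    proof -
      have np: "p \<notin> path_image (l R)" "p \<notin> path_image (h 1 R)" "p \<notin> path_image (v R)" "p \<notin> path_image (h (-1) R)"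
        using S that by auto
      show ?thesis
        unfolding g_def using paths vl np
        by (simp add: winding_number_join winding_number_reversepath valid_path_imp_path
            path_image_join not_in_path_image_join ends'')
    qed
    have int: "F contour_integrable_on \<gamma>" if "valid_path \<gamma>" "path_image \<gamma> \<inter> S = {}" for \<gamma>
      using contour_integrable_holomorphic_simple[OF F] \<open>closed S\<close> that by (auto simp: open_Compl)
    show "contour_integral (g R) F = contour_integral (l R) F + contour_integral (h 1 R) F
         - contour_integral (v R) F - contour_integral (h (- 1) R) F"
      unfolding g_def using paths vl S int
      by (simp add: contour_integrable_reversepath contour_integral_reversepath valid_path_join ends'')
  qed
  have w_tendsto: "((\<lambda>R. winding_number (l R) p + winding_number (h 1 R) p
         - winding_number (v R) p - winding_number (h (- 1) R) p) \<longlongrightarrow> 1 / 2 + 0 - 1 / 2 - 0) at_top"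
    if "p \<in> S" for p
  proof (intro tendsto_intros)
    show "((\<lambda>R. winding_number (l R) p) \<longlongrightarrow> 1 / 2) at_top"
      using left[OF that] by (simp add: left_of_contour_def l_def)
    show "((\<lambda>R. winding_number (v R) p) \<longlongrightarrow> 1 / 2) at_top"
      unfolding v_def using that real d by (intro winding_number_vertical_line) auto
    \<comment> \<open>The winding number of an open segment is the normalised integral of the Cauchy
      kernel, which satisfies the same decay condition as F.\<close>
    have "((\<lambda>R. winding_number (h \<sigma> R) p) \<longlongrightarrow> 0) at_top" if \<sigma>: "\<bar>\<sigma>\<bar> = 1" for \<sigma>
    proof (rule Lim_transform_eventually)
      have "((\<lambda>R. contour_integral (h \<sigma> R) (\<lambda>w. 1 / (w - p))) \<longlongrightarrow> 0) at_top"
        unfolding h_def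
      proof (rule tendsto_contour_integral_horizontal[where S = "{p}"])
        show "(\<lambda>w. 1 / (w - p)) holomorphic_on - {p}" by (auto intro!: holomorphic_intros)
        show "{p} \<subseteq> \<real>" using real \<open>p \<in> S\<close> by auto
        show "\<exists>K. \<forall>s. a \<le> Re s \<longrightarrow> Re s \<le> b \<longrightarrow> 1 \<le> \<bar>Im s\<bar> \<longrightarrow> norm (1 / (s - p)) \<le> K / \<bar>Im s\<bar>" for a b
        proof (intro exI[of _ 1] allI impI)
          fix s assume "1 \<le> \<bar>Im s\<bar>"
          moreover have "\<bar>Im s\<bar> \<le> norm (s - p)"
            using abs_Im_le_cmod[of "s - p"] real \<open>p \<in> S\<close> by (auto simp: complex_is_Real_iff)
          ultimately show "norm (1 / (s - p)) \<le> 1 / \<bar>Im s\<bar>"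
            by (simp add: norm_divide frac_le)
        qed
      qed (use \<sigma> in auto)
      from tendsto_mult_right_zero[OF this]
      show "((\<lambda>R. 1 / (2 * pi * \<i>) * contour_integral (h \<sigma> R) (\<lambda>w. 1 / (w - p))) \<longlongrightarrow> 0) at_top" .
      show "\<forall>\<^sub>F R in at_top. 1 / (2 * pi * \<i>) * contour_integral (h \<sigma> R) (\<lambda>w. 1 / (w - p))
          = winding_number (h \<sigma> R) p"
        using eventually_gt_at_top[of 0]
      proof eventually_elim
        case (elim R)
        then show ?case
          using h_S[of R \<sigma>] paths \<sigma> \<open>p \<in> S\<close> by (subst winding_number_valid_path) auto
      qed
    qed
    from this[of 1] this[of "-1"]
    show "((\<lambda>R. winding_number (h 1 R) p) \<longlongrightarrow> 0) at_top"
      "((\<lambda>R. winding_number (h (- 1) R) p) \<longlongrightarrow> 0) at_top" by auto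
  qed
  have ev1: "\<forall>\<^sub>F R in at_top. \<forall>p\<in>{p\<in>S. K \<le> Re p}. winding_number (g R) p = 0"
  proof (intro eventually_ball_finite fin ballI)
    fix p assume p: "p \<in> {p\<in>S. K \<le> Re p}"
    have "\<forall>\<^sub>F R in at_top. dist (winding_number (l R) p + winding_number (h 1 R) p
         - winding_number (v R) p - winding_number (h (- 1) R) p) (1 / 2 + 0 - 1 / 2 - 0) < 1"
      using w_tendsto[of p] p by (intro tendstoD) auto
    with eventually_gt_at_top[of T'] show "\<forall>\<^sub>F R in at_top. winding_number (g R) p = 0"
    proof eventually_elim
      case (elim R)
      then have "norm (winding_number (g R) p) < 1" using g(5)[of R p] p by (simp add: dist_norm)
      moreover have "winding_number (g R) p \<in> \<int>"
        using g(1-3)[of R] elim p by (intro integer_winding_number) (auto simp: valid_path_imp_path)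
      ultimately show ?case
        by (metis Ints_cases norm_of_int of_int_0 of_int_less_1_iff of_int_abs zabs_less_one_iff)
    qed
  qed
  have "\<forall>\<^sub>F R in at_top. contour_integral (h (- 1) R) F - contour_integral (h 1 R) F
      = contour_integral (l R) F - contour_integral (v R) F"
    using ev1 eventually_gt_at_top[of T']
  proof eventually_elim
    case (elim R)
    note gR = g[OF elim(2)]
    have "(F has_contour_integral 0) (g R)"
    proof (rule Cauchy_theorem_global[OF _ F gR(1-3)])
      show "open (- S)" using \<open>closed S\<close> by auto
      fix w assume "w \<notin> - S"
      show "winding_number (g R) w = 0"
      \<comment> \<open>Of the possibly infinitely many singularities only finitely many have real
        part at least K; the others lie outside a convex half-plane that contains the loop.\<close>
      proof (cases "K \<le> Re w")
        case True
        with elim \<open>w \<notin> - S\<close> show ?thesis by auto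
      next
        case False
        then show ?thesis
          using gR by (intro winding_number_zero_outside[where s = "{w. K \<le> Re w}"])
            (auto simp: valid_path_imp_path convex_halfspace_Re_ge)
      qed
    qed
    then show ?case using gR(6) by (auto dest!: contour_integral_unique simp: algebra_simps)
  qed
  moreover have "((\<lambda>R. contour_integral (h (- 1) R) F - contour_integral (h 1 R) F) \<longlongrightarrow> 0 - 0) at_top"
    unfolding h_def by (intro tendsto_diff tendsto_contour_integral_horizontal[OF F real decay]) auto
  ultimately show ?thesis
    unfolding l_def v_def by (auto intro: Lim_transform_eventually)
qed

section \<open>From contours to Lebesgue integrals along a line\<close>

lemma integrable_real_line_quadratic_decay:
  fixes f :: "real \<Rightarrow> complex"
  assumes cont: "continuous_on UNIV f" and decay: "\<And>t. 1 \<le> \<bar>t\<bar> \<Longrightarrow> norm (f t) \<le> K / t\<^sup>2"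
  shows "integrable lborel f"
proof -
  have "bounded (f ` {-1..1})"
    by (intro compact_imp_bounded compact_continuous_image continuous_on_subset[OF cont]) auto
  then obtain B where B: "0 < B" "\<And>t. t \<in> {-1..1} \<Longrightarrow> norm (f t) \<le> B"
    by (auto simp: bounded_pos)
  have "integrable lborel (\<lambda>t::real. inverse (1 + t\<^sup>2))"
    using integrable_inverse_1_plus_square by (simp add: set_integrable_def)
  \<comment> \<open>One constant for both ranges: \<open>1 + t^2 <= 2\<close> where |t| <= 1, and
    \<open>1 + t^2 <= 2 t^2\<close> beyond. The sign of K is not known, hence |K|.\<close>
  then have "integrable lborel (\<lambda>t::real. 2 * (B + \<bar>K\<bar>) * inverse (1 + t\<^sup>2))"
    by (rule integrable_mult_right)
  then show ?thesis
  proof (rule Bochner_Integration.integrable_bound)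
    show "f \<in> borel_measurable lborel"
      using borel_measurable_continuous_onI[OF cont] by simp
    have "norm (f t) \<le> 2 * (B + \<bar>K\<bar>) * inverse (1 + t\<^sup>2)" for t
    proof (cases "\<bar>t\<bar> \<le> 1")
      case True
      then have "norm (f t) \<le> B" by (intro B(2)) auto
      moreover have "t\<^sup>2 \<le> 1" using True by (simp add: abs_square_le_1)
      ultimately have "norm (f t) * (1 + t\<^sup>2) \<le> B * 2"
        using B(1) by (intro mult_mono) auto
      then show ?thesis
        by (simp add: field_simps add_pos_nonneg)
    next
      case False
      then have "1 \<le> t\<^sup>2" using one_le_power[of "\<bar>t\<bar>" 2] by simp
      moreover from this have "norm (f t) * t\<^sup>2 \<le> \<bar>K\<bar>"
        using False decay[of t] by (auto simp: field_simps)
      ultimately have "norm (f t) * (1 + t\<^sup>2) \<le> 2 * (B + \<bar>K\<bar>)"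
        using mult_left_mono[of 1 "t\<^sup>2" "norm (f t)"] B(1) by (simp add: algebra_simps)
      then show ?thesis
        by (simp add: field_simps add_pos_nonneg)
    qed
    then show "AE t in lborel. norm (f t) \<le> norm (2 * (B + \<bar>K\<bar>) * inverse (1 + t\<^sup>2))"
      using B(1) by (auto simp: abs_mult)
  qed
qed

text \<open>\<open>meijer_G\<close> is defined by a limit of symmetric truncations. Absolute
  integrability identifies that limit with a Lebesgue integral, the form to which Fubini's theorem
  applies; the factor i is the derivative of the parametrisation.\<close>

lemma contour_integral_vertical_line_tendsto:
  assumes F: "integrable lborel (\<lambda>t. F (Complex d t))"
  shows "((\<lambda>R. contour_integral (linepath (Complex d (- R)) (Complex d R)) F)
    \<longlongrightarrow> \<i> * (\<integral>t. F (Complex d t) \<partial>lborel)) at_top"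
proof (rule Lim_transform_eventually)
  have "((\<lambda>R. \<integral>t. indicator {- R..R} t *\<^sub>R F (Complex d t) \<partial>lborel)
      \<longlongrightarrow> (\<integral>t. F (Complex d t) \<partial>lborel)) at_top"
  proof (rule integral_dominated_convergence_at_top[where w = "\<lambda>t. norm (F (Complex d t))"])
    show "AE t in lborel. ((\<lambda>R. indicator {- R..R} t *\<^sub>R F (Complex d t)) \<longlongrightarrow> F (Complex d t)) at_top"
    proof (rule AE_I2, rule tendsto_eventually)
      fix t :: real
      show "\<forall>\<^sub>F R in at_top. indicator {- R..R} t *\<^sub>R F (Complex d t) = F (Complex d t)"
        using eventually_ge_at_top[of "\<bar>t\<bar>"] by eventually_elim (auto simp: indicator_def)
    qed
  qed (use F in \<open>auto simp: indicator_def borel_measurable_integrable\<close>)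
  then show "((\<lambda>R. \<i> * (\<integral>t. indicator {- R..R} t *\<^sub>R F (Complex d t) \<partial>lborel))
      \<longlongrightarrow> \<i> * (\<integral>t. F (Complex d t) \<partial>lborel)) at_top"
    by (intro tendsto_intros)
  show "\<forall>\<^sub>F R in at_top. \<i> * (\<integral>t. indicator {- R..R} t *\<^sub>R F (Complex d t) \<partial>lborel)
      = contour_integral (linepath (Complex d (- R)) (Complex d R)) F"
    using eventually_gt_at_top[of 0]
  proof eventually_elim
    case (elim R)
    have "set_integrable lborel {- R..R} (\<lambda>t. F (Complex d t))"
      using F unfolding set_integrable_def by (intro integrable_mult_indicator) auto
    from set_borel_integral_eq_integral(2)[OF this]
    have "(\<integral>t. indicator {- R..R} t *\<^sub>R F (Complex d t) \<partial>lborel) = integral {- R..R} (\<lambda>t. F (Complex d t))"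
      by (simp add: set_lebesgue_integral_def)
    then show ?case
      using elim by (subst contour_integral_linepath_same_Re[of _ d _ "- R" R]) auto
  qed
qed

lemma vertical_line_left_of_contour:
  assumes "p \<in> \<real>" "Re p < d"
  shows "left_of_contour p (Complex d)"
proof -
  have "Complex d \<circ> linepath (- R) R = linepath (Complex d (- R)) (Complex d R)" for R
    by (auto simp: fun_eq_iff linepath_def complex_eq_iff algebra_simps)
  then show ?thesis
    using winding_number_vertical_line[OF assms] assms by (auto simp: left_of_contour_def)
qed

text \<open>These are the properties that \<open>vertical_contour_deform\<close> asks of its
  exceptional set. For finiteness, a pole \<open>- n - b\<close> with real part at least K forces
  \<open>n <= - K - Re b\<close>.\<close>

lemma meijer_left_poles_of_real:
  assumes "set bs \<subseteq> \<real>"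
  shows "meijer_left_poles (length bs) bs \<subseteq> \<real>"
    and "closed (meijer_left_poles (length bs) bs)"
    and "finite {p \<in> meijer_left_poles (length bs) bs. K \<le> Re p}"
proof -
  have eq: "meijer_left_poles (length bs) bs = (\<Union>b\<in>set bs. (\<lambda>s. b + s) -` \<int>\<^sub>\<le>\<^sub>0)"
    by (auto simp: meijer_left_poles_def)
  show "meijer_left_poles (length bs) bs \<subseteq> \<real>"
  proof
    fix p assume "p \<in> meijer_left_poles (length bs) bs"
    then obtain b where "b \<in> set bs" "b + p \<in> \<int>\<^sub>\<le>\<^sub>0" by (auto simp: eq)
    then have "b \<in> \<real>" "b + p \<in> \<real>" using assms by (auto elim!: nonpos_Ints_cases)
    then show "p \<in> \<real>" using Reals_diff by fastforce
  qed
  show "closed (meijer_left_poles (length bs) bs)"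
    unfolding eq by (intro closed_UN ballI closed_vimage[OF closed_nonpos_Ints]) (auto intro!: continuous_intros)
  have "{p \<in> meijer_left_poles (length bs) bs. K \<le> Re p}
      \<subseteq> (\<Union>b\<in>set bs. (\<lambda>n. - of_nat n - b) ` {..nat \<lceil>- K - Re b\<rceil>})"
  proof
    fix p assume "p \<in> {p \<in> meijer_left_poles (length bs) bs. K \<le> Re p}"
    then obtain b n where b: "b \<in> set bs" "b + p = - of_nat n" "K \<le> Re p"
      by (auto simp: eq elim!: nonpos_Ints_cases')
    then have "p = - of_nat n - b" by (simp add: eq_diff_eq add.commute)
    moreover from this have "n \<le> nat \<lceil>- K - Re b\<rceil>" using b(3) by simp linarith
    ultimately show "p \<in> (\<Union>b\<in>set bs. (\<lambda>n. - of_nat n - b) ` {..nat \<lceil>- K - Re b\<rceil>})"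
      using b by blast
  qed
  then show "finite {p \<in> meijer_left_poles (length bs) bs. K \<le> Re p}"
    by (rule finite_subset) auto
qed

text \<open>Resolves the definite description in \<open>meijer_G\<close>: the line
  \<open>Re s = d\<close> is itself an admissible contour, and deformation gives every other contour
  the same limit. Quadratic decay serves integrability on the line; its weaker consequence of order
  one serves the deformation.\<close>

lemma meijer_G_eq_line_integral:
  fixes as bs :: "complex list" and z :: complex and F :: "complex \<Rightarrow> complex"
  defines "q \<equiv> length bs"
  defines "F \<equiv> meijer_integrand q 0 as bs z"
  assumes bs: "set bs \<subseteq> \<real>"
    and F: "F holomorphic_on - meijer_left_poles q bs"
    and decay: "\<And>a b. \<exists>K. \<forall>s. a \<le> Re s \<longrightarrow> Re s \<le> b \<longrightarrow> 1 \<le> \<bar>Im s\<bar> \<longrightarrow> norm (F s) \<le> K / (Im s)\<^sup>2"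
    and d: "\<And>b. b \<in> set bs \<Longrightarrow> - Re b < d"
  shows "integrable lborel (\<lambda>t. F (Complex d t))"
    and "meijer_G q 0 as bs z = 1 / (2 * pi) * (\<integral>t. F (Complex d t) \<partial>lborel)"
proof -
  let ?S = "meijer_left_poles q bs"
  note S = meijer_left_poles_of_real[OF bs, folded q_def]
  have less: "Re p < d" if "p \<in> ?S" for p
  proof -
    obtain b where b: "b \<in> set bs" "b + p \<in> \<int>\<^sub>\<le>\<^sub>0"
      using \<open>p \<in> ?S\<close> by (auto simp: meijer_left_poles_def q_def)
    from b(2) obtain n where "b + p = - of_nat n" by (rule nonpos_Ints_cases')
    from arg_cong[OF this, of Re] have "Re b + Re p = - real n" by simp
    with d[OF b(1)] show ?thesis by linarith
  qed
  have decay1: "\<exists>K. \<forall>s. a \<le> Re s \<longrightarrow> Re s \<le> b \<longrightarrow> 1 \<le> \<bar>Im s\<bar> \<longrightarrow> norm (F s) \<le> K / \<bar>Im s\<bar>" for a b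
  proof -
    obtain K where K: "\<And>s. a \<le> Re s \<Longrightarrow> Re s \<le> b \<Longrightarrow> 1 \<le> \<bar>Im s\<bar> \<Longrightarrow> norm (F s) \<le> K / (Im s)\<^sup>2"
      using decay by blast
    show ?thesis
    proof (intro exI[of _ K] allI impI)
      fix s assume s: "a \<le> Re s" "Re s \<le> b" "1 \<le> \<bar>Im s\<bar>"
      have "0 \<le> K / (Im s)\<^sup>2" using K[OF s] norm_ge_zero order_trans by blast
      then have "0 \<le> K" using s by (auto simp: zero_le_divide_iff)
      have "\<bar>Im s\<bar> \<le> (Im s)\<^sup>2" using s self_le_power[of "\<bar>Im s\<bar>" 2] by simp
      then have "K / (Im s)\<^sup>2 \<le> K / \<bar>Im s\<bar>"
        using \<open>0 \<le> K\<close> s by (intro divide_left_mono mult_pos_pos) auto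
      with K[OF s] show "norm (F s) \<le> K / \<bar>Im s\<bar>" by linarith
    qed
  qed
  show int: "integrable lborel (\<lambda>t. F (Complex d t))"
  proof -
    obtain K where K: "\<And>s. d \<le> Re s \<Longrightarrow> Re s \<le> d \<Longrightarrow> 1 \<le> \<bar>Im s\<bar> \<Longrightarrow> norm (F s) \<le> K / (Im s)\<^sup>2"
      using decay by blast
    show ?thesis
    proof (rule integrable_real_line_quadratic_decay)
      have *: "continuous_on (range (Complex d)) F"
        by (rule holomorphic_on_imp_continuous_on, rule holomorphic_on_subset[OF F]) (use less in fastforce)
      show "continuous_on UNIV (\<lambda>t. F (Complex d t))"
        using continuous_on_compose[OF _ *] by (simp add: o_def Complex_eq continuous_intros)
      show "norm (F (Complex d t)) \<le> K / t\<^sup>2" if "1 \<le> \<bar>t\<bar>" for t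
        using K[of "Complex d t"] that by simp
    qed
  qed
  have line: "Complex d \<circ> linepath (- R) R = linepath (Complex d (- R)) (Complex d R)" for R
    by (auto simp: fun_eq_iff linepath_def complex_eq_iff algebra_simps)
  let ?G = "1 / (2 * pi) * (\<integral>t. F (Complex d t) \<partial>lborel)"
  have G: "1 / (2 * of_real pi * \<i>) * (\<i> * (\<integral>t. F (Complex d t) \<partial>lborel)) = ?G"
    by simp
  show "meijer_G q 0 as bs z = ?G"
    unfolding meijer_G_def F_def[symmetric]
  proof (rule the_equality)
    \<comment> \<open>With n = 0 the set of right poles is empty, so only winding numbers about left
      poles matter.\<close>
    have "meijer_contour q 0 as bs (Complex d)"
      using S(1) less
      by (auto simp: meijer_contour_def vertical_contour_def line meijer_right_poles_def
          intro!: vertical_line_left_of_contour)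
    moreover have "((\<lambda>R. 1 / (2 * of_real pi * \<i>) * contour_integral (Complex d \<circ> linepath (- R) R) F)
        \<longlongrightarrow> ?G) at_top"
      unfolding line G[symmetric]
      by (intro tendsto_mult tendsto_const contour_integral_vertical_line_tendsto int)
    ultimately show "\<exists>L. meijer_contour q 0 as bs L \<and>
        ((\<lambda>R. 1 / (2 * of_real pi * \<i>) * contour_integral (L \<circ> linepath (- R) R) F) \<longlongrightarrow> ?G) at_top"
      by blast
  next
    fix G' assume "\<exists>L. meijer_contour q 0 as bs L \<and>
        ((\<lambda>R. 1 / (2 * of_real pi * \<i>) * contour_integral (L \<circ> linepath (- R) R) F) \<longlongrightarrow> G') at_top"
    then obtain L where L: "meijer_contour q 0 as bs L"
      and G': "((\<lambda>R. 1 / (2 * of_real pi * \<i>) * contour_integral (L \<circ> linepath (- R) R) F) \<longlongrightarrow> G') at_top"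
      by blast
    have "((\<lambda>R. contour_integral (L \<circ> linepath (- R) R) F
        - contour_integral (linepath (Complex d (- R)) (Complex d R)) F) \<longlongrightarrow> 0) at_top"
      using L by (intro vertical_contour_deform[OF F S(2) S(1) S(3) decay1 _ _ less])
        (auto simp: meijer_contour_def)
    from tendsto_add[OF this contour_integral_vertical_line_tendsto[OF int]]
    have "((\<lambda>R. 1 / (2 * of_real pi * \<i>) * contour_integral (L \<circ> linepath (- R) R) F)
        \<longlongrightarrow> 1 / (2 * of_real pi * \<i>) * (0 + \<i> * (\<integral>t. F (Complex d t) \<partial>lborel))) at_top"
      by (intro tendsto_mult tendsto_const) simp
    from tendsto_unique[OF trivial_limit_at_top_linorder G' this] show "G' = ?G"
      using G by simp
  qed
qed

section \<open>Euler's integral after inversion of the variable\<close>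

text \<open>Substitute \<open>t = c / x\<close> in Euler's integral for \<open>Gamma w\<close>; the
  Jacobian \<open>c / x^2\<close> and one factor \<open>x / c\<close> from the power combine to
  \<open>1 / x\<close>. The power \<open>x^(-w)\<close> is written as an exponential so that it
  merges with the Mellin-Barnes kernel by \<open>exp_add\<close>.\<close>

lemma has_bochner_integral_inverse_gamma:
  fixes c :: real and w :: complex
  assumes c: "0 < c" and w: "0 < Re w"
  shows "has_bochner_integral lborel
    (\<lambda>x. indicator {0<..} x *\<^sub>R (of_real (exp (- c / x) / x) * exp (- w * of_real (ln x))))
    (exp (- w * of_real (ln c)) * Gamma w)"
proof -
  let ?f = "\<lambda>t. complex_of_real t powr (w - 1) / of_real (exp t)"
  let ?k = "\<lambda>x. of_real (exp (- c / x) / x) * exp (- w * of_real (ln x)) :: complex"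
  let ?S = "{0<..} :: real set"
  have img: "(\<lambda>x. c / x) ` ?S = ?S"
  proof safe
    fix y :: real assume "0 < y"
    then show "y \<in> (\<lambda>x. c / x) ` ?S"
      using c by (intro image_eqI[of _ _ "c / y"]) auto
  qed (use c in auto)
  have "(\<lambda>x. \<bar>- c / x\<^sup>2\<bar> *\<^sub>R ?f (c / x)) absolutely_integrable_on ?S \<and>
      integral ?S (\<lambda>x. \<bar>- c / x\<^sup>2\<bar> *\<^sub>R ?f (c / x)) = Gamma w"
  proof (subst has_absolute_integral_change_of_variables_real[where g = "\<lambda>x. c / x"])
    show "((/) c has_field_derivative - c / x\<^sup>2) (at x within ?S)" if "x \<in> ?S" for x
      using that by (auto intro!: derivative_eq_intros simp: power2_eq_square divide_simps)
    show "inj_on ((/) c) ?S" using c by (auto simp: inj_on_def)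
    show "?f absolutely_integrable_on (/) c ` ?S \<and> integral ((/) c ` ?S) ?f = Gamma w"
      using absolutely_integrable_Gamma_integral'[OF w] Gamma_integral_complex'[OF w]
      unfolding img by (simp add: integral_unique)
  qed auto
  moreover have eq: "\<bar>- c / x\<^sup>2\<bar> *\<^sub>R ?f (c / x) = exp (w * of_real (ln c)) * ?k x" if "x \<in> ?S" for x
  proof -
    have x: "0 < x" using that by simp
    have "(complex_of_real (c / x)) powr (w - 1) = exp ((w - 1) * of_real (ln c - ln x))"
      using c x by (simp add: powr_def Ln_of_real ln_div flip: of_real_divide)
    also have "\<dots> = exp (w * of_real (ln c)) * exp (- w * of_real (ln x)) * (exp (- of_real (ln c)) * exp (of_real (ln x)))"
      by (simp add: algebra_simps flip: exp_add)
    also have "exp (- of_real (ln c)) * exp (of_real (ln x)) = complex_of_real (x / c)"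
      using c x by (simp add: exp_minus divide_inverse exp_of_real flip: of_real_inverse)
    finally have powr: "(complex_of_real (c / x)) powr (w - 1)
        = exp (w * of_real (ln c)) * exp (- w * of_real (ln x)) * complex_of_real (x / c)"
      by (simp add: mult.assoc)
    have "c / x\<^sup>2 * (x / c) / exp (c / x) = exp (- c / x) / x"
      using c x by (simp add: power2_eq_square exp_minus field_simps)
    then have "complex_of_real (c / x\<^sup>2) * of_real (x / c) / of_real (exp (c / x)) = of_real (exp (- c / x) / x)"
      by (simp only: flip: of_real_mult of_real_divide)
    then show ?thesis
      unfolding powr using c x
      by (simp only: abs_minus_cancel minus_divide_left[symmetric] scaleR_conv_of_real)
         (simp add: field_simps)
  qed
  ultimately have "(\<lambda>x. exp (w * of_real (ln c)) * ?k x) absolutely_integrable_on ?S \<and>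
      integral ?S (\<lambda>x. exp (w * of_real (ln c)) * ?k x) = Gamma w"
    by (metis (no_types, lifting) Henstock_Kurzweil_Integration.integral_cong set_integrable_cong)
  then have *: "?k absolutely_integrable_on ?S" "exp (w * of_real (ln c)) * integral ?S ?k = Gamma w"
    by (simp_all only: set_integrable_mult_right_iff Henstock_Kurzweil_Integration.integral_mult_right exp_not_eq_zero not_False_eq_True simp_thms)
  \<comment> \<open>\<open>absolutely_integrable_on\<close> refers to the completed measure; Borel
    measurability allows the passage to \<open>lborel\<close>.\<close>
  have meas: "(\<lambda>x. indicator ?S x *\<^sub>R ?k x) \<in> borel_measurable lborel"
    by measurable
  have "integral\<^sup>L lborel (\<lambda>x. indicator ?S x *\<^sub>R ?k x) = integral ?S ?k"
    using set_lebesgue_integral_eq_integral(2)[OF *(1)] integral_completion[OF meas]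
    by (simp add: set_lebesgue_integral_def)
  moreover have "integrable lborel (\<lambda>x. indicator ?S x *\<^sub>R ?k x)"
    using *(1) integrable_completion[OF meas] by (simp add: set_integrable_def)
  moreover have "integral ?S ?k = exp (- w * of_real (ln c)) * Gamma w"
    by (simp add: *(2)[symmetric] flip: exp_add mult.assoc)
  ultimately show ?thesis by (simp add: has_bochner_integral_iff)
qed

section \<open>G-functions with real parameters and positive argument\<close>

lemma Gamma_prod_list_bounded_on_strip:
  fixes cs :: "real list" and a b :: real and k :: nat
  shows "\<exists>K\<ge>0. \<forall>s. a \<le> Re s \<longrightarrow> Re s \<le> b \<longrightarrow> 1 \<le> \<bar>Im s\<bar> \<longrightarrow>
    norm (\<Prod>c\<leftarrow>cs. Gamma (of_real c + s)) \<le> K / \<bar>Im s\<bar> ^ (k * length cs)"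
proof (induction cs)
  case Nil
  show ?case by (rule exI[of _ 1]) auto
next
  case (Cons c cs)
  then obtain K where K: "0 \<le> K" "\<And>s. a \<le> Re s \<Longrightarrow> Re s \<le> b \<Longrightarrow> 1 \<le> \<bar>Im s\<bar> \<Longrightarrow>
    norm (\<Prod>c\<leftarrow>cs. Gamma (of_real c + s)) \<le> K / \<bar>Im s\<bar> ^ (k * length cs)" by blast
  obtain K' where K': "0 \<le> K'" "\<And>s. a + c \<le> Re s \<Longrightarrow> Re s \<le> b + c \<Longrightarrow> 1 \<le> \<bar>Im s\<bar> \<Longrightarrow>
      norm (Gamma s) \<le> K' / \<bar>Im s\<bar> ^ k"
    using Gamma_bounded_on_strip by blast
  show ?case
  proof (intro exI[of _ "K' * K"] conjI allI impI)
    fix s assume s: "a \<le> Re s" "Re s \<le> b" "1 \<le> \<bar>Im s\<bar>"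
    have "norm (\<Prod>c\<leftarrow>c # cs. Gamma (of_real c + s))
        = norm (Gamma (of_real c + s)) * norm (\<Prod>c\<leftarrow>cs. Gamma (of_real c + s))"
      by (simp add: norm_mult)
    also have "\<dots> \<le> (K' / \<bar>Im s\<bar> ^ k) * (K / \<bar>Im s\<bar> ^ (k * length cs))"
      using K(2)[OF s] K'(2)[of "of_real c + s"] s K'(1) by (intro mult_mono) auto
    finally show "norm (\<Prod>c\<leftarrow>c # cs. Gamma (of_real c + s)) \<le> K' * K / \<bar>Im s\<bar> ^ (k * length (c # cs))"
      by (simp add: power_add)
  qed (use K K' in auto)
qed

lemma holomorphic_on_prod_list:
  assumes "\<And>x. x \<in> set xs \<Longrightarrow> f x holomorphic_on A"
  shows "(\<lambda>s. \<Prod>x\<leftarrow>xs. f x s) holomorphic_on A"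
  using assms by (induction xs) (auto intro!: holomorphic_intros)

text \<open>
  Gamma factors of the numerator and denominator may share poles and zeros; the list \<open>cs\<close> names
  Gamma factors that still dominate the quotient after cancellation and so provide the decay.
\<close>

lemma meijer_G_real_line_integral:
  fixes as bs cs :: "real list" and z d :: real
  defines "K \<equiv> \<lambda>s. (\<Prod>b\<leftarrow>bs. Gamma (of_real b + s)) / (\<Prod>a\<leftarrow>as. Gamma (of_real a + s))"
  assumes z: "0 < z" and "cs \<noteq> []"
    and bound: "\<And>s. 1 \<le> \<bar>Im s\<bar> \<Longrightarrow> norm (K s) \<le> norm (\<Prod>c\<leftarrow>cs. Gamma (of_real c + s))"
    and d: "\<And>b. b \<in> set bs \<Longrightarrow> - b < d"
  shows "integrable lborel (\<lambda>t. K (Complex d t) * exp (- Complex d t * of_real (ln z)))"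
    and "meijer_G (length bs) 0 (map of_real as) (map of_real bs) (of_real z)
      = 1 / (2 * pi) * (\<integral>t. K (Complex d t) * exp (- Complex d t * of_real (ln z)) \<partial>lborel)"
    and "meijer_G (length bs) 0 (map of_real as) (map of_real bs) (of_real z) \<in> \<real>"
proof -
  let ?bs = "map complex_of_real bs" and ?as = "map complex_of_real as"
  let ?F = "meijer_integrand (length ?bs) 0 ?as ?bs (of_real z)"
  have F: "?F s = K s * exp (- s * of_real (ln z))" for s
    using z by (simp add: meijer_integrand_def K_def o_def powr_def Ln_of_real)
  \<comment> \<open>Reciprocal Gamma functions are entire, so in this form the singularities can
    only be left poles of the numerator.\<close>
  have K: "K s = (\<Prod>b\<leftarrow>bs. Gamma (of_real b + s)) * (\<Prod>a\<leftarrow>as. rGamma (of_real a + s))" for s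
  proof -
    have "inverse (\<Prod>a\<leftarrow>as. Gamma (of_real a + s)) = (\<Prod>a\<leftarrow>as. rGamma (of_real a + s))"
      by (induction as) (auto simp: rGamma_inverse_Gamma)
    then show ?thesis by (simp add: K_def divide_inverse)
  qed
  have holo: "?F holomorphic_on - meijer_left_poles (length ?bs) ?bs"
    unfolding F K
    by (intro holomorphic_intros holomorphic_on_prod_list) (auto simp: meijer_left_poles_def)
  have decay: "\<exists>C. \<forall>s. a \<le> Re s \<longrightarrow> Re s \<le> b \<longrightarrow> 1 \<le> \<bar>Im s\<bar> \<longrightarrow> norm (?F s) \<le> C / (Im s)\<^sup>2" for a b
  proof -
    \<comment> \<open>Order 2 for each Gamma factor in \<open>cs\<close>; as \<open>cs\<close> is
      nonempty, the total is at least quadratic.\<close>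
    obtain C where C: "0 \<le> C" "\<And>s. a \<le> Re s \<Longrightarrow> Re s \<le> b \<Longrightarrow> 1 \<le> \<bar>Im s\<bar> \<Longrightarrow>
        norm (\<Prod>c\<leftarrow>cs. Gamma (of_real c + s)) \<le> C / \<bar>Im s\<bar> ^ (2 * length cs)"
      using Gamma_prod_list_bounded_on_strip[of a b cs 2] by blast
    define E where "E = exp ((\<bar>a\<bar> + \<bar>b\<bar>) * \<bar>ln z\<bar>)"
    show ?thesis
    proof (intro exI[of _ "C * E"] allI impI)
      fix s assume s: "a \<le> Re s" "Re s \<le> b" "1 \<le> \<bar>Im s\<bar>"
      have "\<bar>Im s\<bar> ^ 2 \<le> \<bar>Im s\<bar> ^ (2 * length cs)"
        using s \<open>cs \<noteq> []\<close> by (intro power_increasing) (auto simp: Suc_le_eq)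
      then have "C / \<bar>Im s\<bar> ^ (2 * length cs) \<le> C / \<bar>Im s\<bar> ^ 2"
        using s C(1) by (intro divide_left_mono mult_pos_pos zero_less_power) auto
      with bound[OF s(3)] C(2)[OF s] have 1: "norm (K s) \<le> C / (Im s)\<^sup>2" by simp
      have "\<bar>Re s * ln z\<bar> \<le> (\<bar>a\<bar> + \<bar>b\<bar>) * \<bar>ln z\<bar>"
        unfolding abs_mult using s by (intro mult_right_mono) auto
      then have "norm (exp (- s * of_real (ln z))) \<le> E"
        by (simp add: E_def)
      with 1 have "norm (K s) * norm (exp (- s * of_real (ln z))) \<le> (C / (Im s)\<^sup>2) * E"
        using C(1) by (intro mult_mono) auto
      then show "norm (?F s) \<le> C * E / (Im s)\<^sup>2"
        unfolding F norm_mult by simp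
    qed
  qed
  have d': "- Re b < d" if "b \<in> set ?bs" for b using d that by auto
  have real: "set ?bs \<subseteq> \<real>" by auto
  note L = meijer_G_eq_line_integral[OF real holo decay d']
  show "integrable lborel (\<lambda>t. K (Complex d t) * exp (- Complex d t * of_real (ln z)))"
    using L(1) by (simp only: F)
  show G: "meijer_G (length bs) 0 (map of_real as) (map of_real bs) (of_real z)
      = 1 / (2 * pi) * (\<integral>t. K (Complex d t) * exp (- Complex d t * of_real (ln z)) \<partial>lborel)"
    using L(2) unfolding F by simp
  let ?h = "\<lambda>t. K (Complex d t) * exp (- Complex d t * of_real (ln z))"
  \<comment> \<open>Reality: conjugation turns the integrand at t into the one at -t, and reflecting
    the line preserves the integral.\<close>
  have cnj_prod: "cnj (\<Prod>x\<leftarrow>xs. Gamma (of_real x + s)) = (\<Prod>x\<leftarrow>xs. Gamma (of_real x + cnj s))" for xs s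
    by (induction xs) (auto simp: cnj_Gamma)
  have cnj: "cnj (Complex d t) = Complex d (- t)" for t by (simp add: complex_eq_iff)
  have cnj_h: "cnj (?h t) = ?h (- t)" for t
    by (simp add: K_def cnj_prod exp_cnj cnj)
  have "cnj (integral\<^sup>L lborel ?h) = (\<integral>t. ?h (- t) \<partial>lborel)"
    unfolding cnj_h[symmetric] by (rule Bochner_Integration.integral_cnj[symmetric])
  also have "\<dots> = integral\<^sup>L lborel ?h"
    using lborel_integral_real_affine[of "- 1" ?h 0] by simp
  finally show "meijer_G (length bs) 0 (map of_real as) (map of_real bs) (of_real z) \<in> \<real>"
    unfolding G Reals_cnj_iff by simp
qed

section \<open>The inverse exponential moment of a G-function density\<close>

lemma Re_pos_notin_nonpos_Ints: "0 < Re z \<Longrightarrow> z \<notin> \<int>\<^sub>\<le>\<^sub>0"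
  by (auto elim!: nonpos_Ints_cases)

text \<open>By the functional equation the quotient is \<open>1 / (x + s)\<close>. It disposes of
  the pair \<xi>^2, \<xi>^2 + 1 in the kernel, so that the remaining Gammas carry the decay.\<close>

lemma norm_Gamma_quotient_le_1:
  fixes x :: real
  assumes "1 \<le> \<bar>Im s\<bar>"
  shows "norm (Gamma (of_real x + s) / Gamma (of_real x + 1 + s)) \<le> 1"
proof -
  have nz: "of_real x + s \<notin> \<int>\<^sub>\<le>\<^sub>0"
    using assms by (auto elim!: nonpos_Ints_cases simp: complex_eq_iff)
  then have "Gamma (of_real x + s + 1) = (of_real x + s) * Gamma (of_real x + s)"
    by (intro Gamma_plus1)
  moreover have "1 \<le> norm (of_real x + s)"
    using assms abs_Im_le_cmod[of "of_real x + s"] by simp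
  ultimately show ?thesis
    using nz by (simp add: norm_divide norm_mult Gamma_eq_zero_iff add_ac divide_simps)
qed

text \<open>Legendre's duplication formula at \<open>x / 2 + w\<close>, solved for the Gamma of the
  doubled argument. The hypotheses keep both half-arguments off the poles.\<close>

lemma Gamma_double:
  fixes x :: real
  assumes "0 \<le> x" "0 < Re w"
  shows "Gamma (of_real x + 2 * w) = exp ((of_real x + 2 * w - 1) * of_real (ln 2)) / of_real (sqrt pi) *
    (Gamma (of_real (x / 2) + w) * Gamma (of_real ((x + 1) / 2) + w))"
proof -
  let ?y = "of_real (x / 2) + w"
  have "0 < Re ?y" "0 < Re (?y + 1 / 2)" using assms by auto
  from Gamma_legendre_duplication[OF this[THEN Re_pos_notin_nonpos_Ints]]
  have leg: "Gamma ?y * Gamma (?y + 1 / 2) = exp ((1 - 2 * ?y) * of_real (ln 2)) * of_real (sqrt pi) * Gamma (2 * ?y)" .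
  have eqs: "2 * ?y = of_real x + 2 * w" "?y + 1 / 2 = of_real ((x + 1) / 2) + w"
    by (simp_all add: add_divide_distrib)
  define X where "X = of_real x + 2 * w"
  have alg: "p / s * (q * s * G) = (p * q) * G" if "s \<noteq> 0" for p q s G :: complex
    using that by simp
  have "exp ((X - 1) * of_real (ln 2)) * exp ((1 - X) * of_real (ln 2)) = exp 0"
    unfolding exp_add[symmetric] by (rule arg_cong[where f = exp]) (simp only: distrib_right[symmetric], simp)
  then have "exp ((X - 1) * of_real (ln 2)) / of_real (sqrt pi)
      * (exp ((1 - X) * of_real (ln 2)) * of_real (sqrt pi) * Gamma X) = Gamma X"
    using alg[of "of_real (sqrt pi)"] by simp
  then show ?thesis
    using leg unfolding eqs X_def[symmetric] by (simp only:)
qed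

lemma Delta_1: "Delta 1 x = [x]"
  by (simp add: Delta_def)

lemma Delta_2: "Delta 2 x = [x / 2, (x + 1) / 2]"
  by (simp add: Delta_def numeral_2_eq_2)

text \<open>For r = 2 each \<open>Gamma (x + 2 w)\<close> contributes
  \<open>2^(x + 2 w - 1) / sqrt pi\<close>. Three such factors over one leave
  \<open>2^(alpha + nu - 3 + 4 w) / pi\<close>, in which a has cancelled. The free factor
  \<open>Gamma w\<close> becomes the list entry 0.\<close>

lemma meijer_kernel_multiplication:
  fixes a \<alpha> \<nu> :: real and r :: nat
  assumes "r \<in> {1, 2}" "0 \<le> a" "0 \<le> \<alpha>" "0 \<le> \<nu>" and w: "0 < Re w"
  shows "(\<Prod>b\<leftarrow>[a, \<alpha>, \<nu>]. Gamma (of_real b + of_nat r * w)) / (\<Prod>b\<leftarrow>[a + 1]. Gamma (of_real b + of_nat r * w)) * Gamma w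
    = of_real (real r powr (\<alpha> + \<nu> - 2) / (2 * pi) ^ (r - 1)) * exp (2 * of_nat r * w * of_real (ln (real r))) *
      ((\<Prod>b\<leftarrow>Delta r a @ Delta r \<alpha> @ Delta r \<nu> @ [0]. Gamma (of_real b + w)) /
       (\<Prod>b\<leftarrow>Delta r (a + 1). Gamma (of_real b + w)))"
proof (cases "r = 1")
  case True
  then show ?thesis by (simp add: Delta_1[simplified])
next
  case False
  then have r: "r = 2" using assms(1) by simp
  define e where "e x = exp ((of_real x + 2 * w - 1) * of_real (ln 2))" for x :: real
  \<comment> \<open>The separate division by 2 joins the \<pi> from the square roots to form the
    \<open>2 * pi\<close> of the statement.\<close>
  have e: "e a * e \<alpha> * e \<nu> / e (a + 1) = of_real (2 powr (\<alpha> + \<nu> - 2)) / 2 * exp (4 * w * of_real (ln 2))"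
  proof -
    have "exp (- complex_of_real (ln 2)) = 1 / 2"
      by (simp add: exp_minus exp_of_real)
    moreover have "complex_of_real (2 powr (\<alpha> + \<nu> - 2)) = exp (of_real ((\<alpha> + \<nu> - 2) * ln 2))"
      unfolding exp_of_real by (simp add: powr_def)
    ultimately have "complex_of_real (2 powr (\<alpha> + \<nu> - 2)) / 2 = exp (of_real ((\<alpha> + \<nu> - 2) * ln 2)) * exp (- of_real (ln 2))"
      by simp
    then show ?thesis
      unfolding e_def by (simp only: exp_add[symmetric] exp_diff[symmetric])
        (rule arg_cong[where f = exp], simp add: algebra_simps)
  qed
  have pi: "complex_of_real (sqrt pi) * of_real (sqrt pi) = of_real pi"
    by (simp flip: of_real_mult)
  define G where "G x = Gamma (of_real (x / 2) + w) * Gamma (of_real ((x + 1) / 2) + w)" for x :: real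
  have D: "Gamma (of_real x + 2 * w) = e x / of_real (sqrt pi) * G x" if "0 \<le> x" for x
    using Gamma_double[OF that w] unfolding e_def G_def .
  have "0 \<le> a + 1" using assms by simp
  have nz: "e x \<noteq> 0" for x by (simp add: e_def)
  \<comment> \<open>V, the Gamma product of the denominator, need not be shown nonzero: if V = 0,
    both sides are 0.\<close>
  have alg: "(p / s * P) * ((q / s * Q) * (u / s * U)) / (v / s * V) * W = (p * q * u / v) / (s * s) * (P * Q * U * W / V)"
    if "s \<noteq> 0" "v \<noteq> 0" for p q u v s P Q U V W :: complex
    using that by (cases "V = 0") (auto simp: field_simps)
  have "Gamma (of_real a + 2 * w) * (Gamma (of_real \<alpha> + 2 * w) * Gamma (of_real \<nu> + 2 * w)) / Gamma (of_real (a + 1) + 2 * w) * Gamma w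
     = (e a * e \<alpha> * e \<nu> / e (a + 1)) / of_real pi * (G a * G \<alpha> * G \<nu> * Gamma w / G (a + 1))"
    unfolding pi[symmetric] D[OF assms(2)] D[OF assms(3)] D[OF assms(4)] D[OF \<open>0 \<le> a + 1\<close>]
    using nz by (intro alg) auto
  moreover have "(\<Prod>b\<leftarrow>Delta 2 a @ Delta 2 \<alpha> @ Delta 2 \<nu> @ [0]. Gamma (of_real b + w)) /
       (\<Prod>b\<leftarrow>Delta 2 (a + 1). Gamma (of_real b + w)) = G a * G \<alpha> * G \<nu> * Gamma w / G (a + 1)"
    by (simp add: Delta_2 G_def mult.assoc)
  ultimately show ?thesis
    unfolding e r by (simp add: mult.assoc)
qed

text \<open>Raising a by 1 drops the first entry \<open>a / r\<close> of \<open>Delta r a\<close>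
  and appends \<open>a / r + 1\<close>. All other Gammas cancel and a single quotient
  \<open>1 / (a / r + s)\<close> is left.\<close>

lemma norm_Delta_Gamma_quotient_le_1:
  assumes "r \<in> {1, 2}" "1 \<le> \<bar>Im s\<bar>"
  shows "norm ((\<Prod>b\<leftarrow>Delta r a. Gamma (of_real b + s)) / (\<Prod>b\<leftarrow>Delta r (a + 1). Gamma (of_real b + s))) \<le> 1"
proof (cases "r = 1")
  case True
  then show ?thesis
    using norm_Gamma_quotient_le_1[OF assms(2), of a] by (simp add: Delta_1[simplified])
next
  case False
  then have r: "r = 2" using assms(1) by simp
  have "(a + 1 + 1) / 2 = a / 2 + 1" by simp
  then have eq: "(\<Prod>b\<leftarrow>Delta r a. Gamma (of_real b + s)) / (\<Prod>b\<leftarrow>Delta r (a + 1). Gamma (of_real b + s))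
    = Gamma (of_real (a / 2) + s) * Gamma (of_real ((a + 1) / 2) + s) /
      (Gamma (of_real ((a + 1) / 2) + s) * Gamma (of_real (a / 2) + 1 + s))"
    by (simp only: r Delta_2 list.map prod_list.Cons prod_list.Nil mult_1_right of_real_add of_real_1)
  show ?thesis
  proof (cases "Gamma (of_real ((a + 1) / 2) + s) = 0")
    case False
    then show ?thesis
      using norm_Gamma_quotient_le_1[OF assms(2), of "a / 2"] unfolding eq
      by (metis mult.commute nonzero_mult_divide_mult_cancel_right)
  qed (simp add: eq)
qed

section \<open>The exchange of integrals\<close>

text \<open>The factor \<open>1 / x\<close> of the density is kept with the exponential, so that the
  integral over x is exactly \<open>c^(-s/r) Gamma (s/r)\<close>. The second conclusion is needed
  because \<open>optical_density\<close> takes real parts: it shows that nothing is lost by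
  them.\<close>

lemma meijer_G_inverse_moment:
  fixes a \<alpha> \<nu> B \<mu> c :: real and r :: nat
  assumes r: "r \<in> {1, 2}" and "0 < a" "0 < \<alpha>" "0 < \<nu>" "0 < B" "0 < \<mu>" "0 < c"
  defines "G \<equiv> \<lambda>x. meijer_G 3 0 (map complex_of_real [a + 1]) (map complex_of_real [a, \<alpha>, \<nu>])
    (complex_of_real (B * (x / \<mu>) powr (1 / real r)))"
  shows "has_bochner_integral lborel (\<lambda>x. indicator {0<..} x *\<^sub>R (of_real (exp (- c / x) / x) * G x))
     (of_real (real r powr (\<alpha> + \<nu> - 1) / (2 * pi) ^ (r - 1)) *
       meijer_G (3 * r + 1) 0 (map complex_of_real (Delta r (a + 1)))
         (map complex_of_real (Delta r a @ Delta r \<alpha> @ Delta r \<nu> @ [0]))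
         (complex_of_real (c / \<mu> * (B / (real r)\<^sup>2) ^ r)))"
    and "meijer_G (3 * r + 1) 0 (map complex_of_real (Delta r (a + 1)))
         (map complex_of_real (Delta r a @ Delta r \<alpha> @ Delta r \<nu> @ [0]))
         (complex_of_real (c / \<mu> * (B / (real r)\<^sup>2) ^ r)) \<in> \<real>"
proof -
  define K where "K s = (\<Prod>b\<leftarrow>[a, \<alpha>, \<nu>]. Gamma (complex_of_real b + s)) / (\<Prod>b\<leftarrow>[a + 1]. Gamma (complex_of_real b + s))" for s
  define bs where "bs = Delta r a @ Delta r \<alpha> @ Delta r \<nu> @ [0]"
  define R where "R s = (\<Prod>b\<leftarrow>bs. Gamma (complex_of_real b + s)) / (\<Prod>b\<leftarrow>Delta r (a + 1). Gamma (complex_of_real b + s))" for s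
  \<comment> \<open>The line \<open>Re s = r\<close> for the inner G-function becomes \<open>Re w = 1\<close> under \<open>s = r * w\<close>.\<close>
  define s where "s t = of_real (real r) + \<i> * complex_of_real t" for t
  have s_Complex: "s t = Complex (real r) t" for t by (simp add: s_def Complex_eq)
  have r0: "0 < real r" using r by auto
  define z where "z x = B * (x / \<mu>) powr (1 / real r)" for x
  \<comment> \<open>The logarithm of the G-function's argument, affine in \<open>ln x\<close>: the
    kernel \<open>exp (- s * lz x)\<close> splits into a factor free of x (\<open>e\<close> below)
    and the power \<open>x^(-s/r)\<close>.\<close>
  define lz where "lz x = ln B + (ln x - ln \<mu>) / real r" for x
  have z: "0 < z x" "ln (z x) = lz x" if "0 < x" for x
    using that assms by (simp_all add: z_def lz_def ln_mult ln_div ln_powr)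
  have K_bound: "norm (K s) \<le> norm (\<Prod>b\<leftarrow>[\<alpha>, \<nu>]. Gamma (complex_of_real b + s))" if "1 \<le> \<bar>Im s\<bar>" for s
  proof -
    have "norm (K s) = norm (Gamma (complex_of_real a + s) / Gamma (complex_of_real a + 1 + s)) *
        norm (\<Prod>b\<leftarrow>[\<alpha>, \<nu>]. Gamma (complex_of_real b + s))"
      by (simp add: K_def norm_mult norm_divide)
    also have "\<dots> \<le> 1 * norm (\<Prod>b\<leftarrow>[\<alpha>, \<nu>]. Gamma (complex_of_real b + s))"
      by (intro mult_right_mono norm_Gamma_quotient_le_1 that) auto
    finally show ?thesis by simp
  qed
  have K_pos: "- b < real r" if "b \<in> set [a, \<alpha>, \<nu>]" for b
    using that assms r0 by auto
  have K_int: "integrable lborel (\<lambda>t. K (s t))"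
    using meijer_G_real_line_integral(1)[of 1 "[\<alpha>, \<nu>]" "[a, \<alpha>, \<nu>]" "[a + 1]" "real r"] K_bound K_pos
    by (simp add: K_def s_Complex)
  have G: "of_real (2 * pi) * G x = (\<integral>t. K (s t) * exp (- s t * of_real (lz x)) \<partial>lborel)" if "0 < x" for x
    using meijer_G_real_line_integral(2)[OF z(1)[OF that], of "[\<alpha>, \<nu>]" "[a, \<alpha>, \<nu>]" "[a + 1]" "real r"] K_bound K_pos
    unfolding K_def[symmetric] s_Complex[symmetric] z(2)[OF that] G_def z_def[symmetric]
    by (simp add: numeral_3_eq_3)

  have R_bound: "norm (R s) \<le> norm (\<Prod>b\<leftarrow>Delta r \<alpha> @ Delta r \<nu> @ [0]. Gamma (complex_of_real b + s))"
    if "1 \<le> \<bar>Im s\<bar>" for s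
  proof -
    have "norm (R s) = norm ((\<Prod>b\<leftarrow>Delta r a. Gamma (of_real b + s)) / (\<Prod>b\<leftarrow>Delta r (a + 1). Gamma (of_real b + s))) *
        norm (\<Prod>b\<leftarrow>Delta r \<alpha> @ Delta r \<nu> @ [0]. Gamma (complex_of_real b + s))"
      by (simp add: R_def bs_def norm_mult norm_divide)
    also have "\<dots> \<le> 1 * norm (\<Prod>b\<leftarrow>Delta r \<alpha> @ Delta r \<nu> @ [0]. Gamma (complex_of_real b + s))"
      by (intro mult_right_mono norm_Delta_Gamma_quotient_le_1 that r) auto
    finally show ?thesis by simp
  qed
  have R_pos: "- b < 1" if "b \<in> set bs" for b
  proof -
    have "0 \<le> b" using that assms by (auto simp: bs_def Delta_def)
    then show ?thesis by simp
  qed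
  define W where "W = c / \<mu> * (B / (real r)\<^sup>2) ^ r"
  have W: "0 < W" using assms r0 by (simp add: W_def)
  have lnW: "ln W = ln c - ln \<mu> + real r * (ln B - 2 * ln (real r))"
    using assms r0 by (simp add: W_def ln_mult ln_div ln_realpow)
  define GR where "GR = meijer_G (3 * r + 1) 0 (map complex_of_real (Delta r (a + 1))) (map complex_of_real bs) (complex_of_real W)"
  have "length bs = 3 * r + 1" by (simp add: bs_def Delta_def)
  have GR_real: "GR \<in> \<real>"
    using meijer_G_real_line_integral(3)[OF W, of "Delta r \<alpha> @ Delta r \<nu> @ [0]" bs "Delta r (a + 1)" 1] R_bound R_pos
      \<open>length bs = 3 * r + 1\<close>
    unfolding R_def[symmetric] GR_def by simp
  have GR: "of_real (2 * pi) * GR = (\<integral>u. R (Complex 1 u) * exp (- Complex 1 u * of_real (ln W)) \<partial>lborel)"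
    using meijer_G_real_line_integral(2)[OF W, of "Delta r \<alpha> @ Delta r \<nu> @ [0]" bs "Delta r (a + 1)" 1] R_bound R_pos
      \<open>length bs = 3 * r + 1\<close>
    unfolding R_def[symmetric] GR_def by simp

  define e where "e t = exp (- s t * of_real (ln B - ln \<mu> / real r))" for t
  define f where "f t x = indicator {0<..} x *\<^sub>R (of_real (exp (- c / x) / x) * (K (s t) * exp (- s t * of_real (lz x))))"
    for t x :: real
  define h where "h t x = indicator {0<..} x *\<^sub>R (of_real (exp (- c / x) / x) * exp (- (s t / of_nat r) * of_real (ln x)))"
    for t x :: real
  have f_h: "f t x = K (s t) * e t * h t x" for t x
  proof -
    have "exp (- s t * of_real (lz x)) = e t * exp (- (s t / of_nat r) * of_real (ln x))"
      unfolding e_def exp_add[symmetric] using r0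
      by (intro arg_cong[where f = exp]) (simp add: lz_def field_simps)
    then show ?thesis by (simp add: f_def h_def mult_ac)
  qed
  have Re_s: "Re (s t / of_nat r) = 1" for t using r0 by (simp add: s_def)
  have h: "has_bochner_integral lborel (h t) (exp (- (s t / of_nat r) * of_real (ln c)) * Gamma (s t / of_nat r))" for t
    unfolding h_def using Re_s[of t] by (intro has_bochner_integral_inverse_gamma \<open>0 < c\<close>) (simp only: zero_less_one)
  have norm_exp: "norm (exp (- z * complex_of_real y)) = exp (- (Re z * y))" for z y
    by simp
  \<comment> \<open>\<open>Re (s t)\<close> is constant, so the moduli of \<open>h t x\<close> and
    \<open>e t\<close> do not depend on t. Hence the modulus of f is a product of a function of t
    and a function of x, and joint integrability reduces to that of K on the line and of
    \<open>h 0\<close>.\<close>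
  have norm_h: "norm (h t x) = norm (h 0 x)" for t x
    unfolding h_def norm_scaleR norm_mult norm_exp Re_s ..
  have norm_e: "norm (e t) = norm (e 0)" for t
    by (simp add: e_def s_def)

  \<comment> \<open>Measurability of K along the line is read off from its integrability.\<close>
  define Ks where "Ks t = K (s t)" for t
  have [measurable]: "Ks \<in> borel_measurable borel"
    using borel_measurable_integrable[OF K_int] by (simp add: Ks_def[abs_def])
  have [measurable]: "s \<in> borel_measurable borel" "lz \<in> borel_measurable borel"
    unfolding s_def[abs_def] lz_def[abs_def] by measurable
  have meas: "case_prod f \<in> borel_measurable (lborel \<Otimes>\<^sub>M lborel)"
    unfolding f_def Ks_def[symmetric] by measurable
  have f_int: "integrable (lborel \<Otimes>\<^sub>M lborel) (case_prod f)"
  proof (rule lborel_pair.Fubini_integrable[OF meas])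
    have "(\<integral>x. norm (case (t, x) of (t, x) \<Rightarrow> f t x) \<partial>lborel) = norm (K (s t)) * (norm (e 0) * (\<integral>x. norm (h 0 x) \<partial>lborel))" for t
      by (simp add: f_h norm_mult norm_h[of t] norm_e[of t] mult.assoc)
    then show "integrable lborel (\<lambda>t. \<integral>x. norm (case (t, x) of (t, x) \<Rightarrow> f t x) \<partial>lborel)"
      using K_int by simp
    show "AE t in lborel. integrable lborel (\<lambda>x. case (t, x) of (t, x) \<Rightarrow> f t x)"
      using h by (auto simp: f_h has_bochner_integral_iff)
  qed
  have inner_t: "(\<integral>t. f t x \<partial>lborel) = of_real (2 * pi) * (indicator {0<..} x *\<^sub>R (of_real (exp (- c / x) / x) * G x))" for x
  proof (cases "0 < x")
    case True
    then have "(\<integral>t. f t x \<partial>lborel) = of_real (exp (- c / x) / x) * (of_real (2 * pi) * G x)"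
      unfolding G[OF True] by (simp add: f_def)
    then show ?thesis using True by simp
  qed (simp add: f_def)
  have inner_x: "(\<integral>x. f t x \<partial>lborel) = K (s t) * e t * (exp (- (s t / of_nat r) * of_real (ln c)) * Gamma (s t / of_nat r))" for t
    using h[of t] by (simp add: f_h has_bochner_integral_iff)
  define \<kappa> where "\<kappa> = real r powr (\<alpha> + \<nu> - 2) / (2 * pi) ^ (r - 1)"
  \<comment> \<open>Under \<open>t = r u\<close> the line becomes \<open>s = r w\<close> with
    \<open>Re w = 1\<close>; the powers of c, \<mu>, B and r with exponent proportional to w merge
    into \<open>W^(-w)\<close>.\<close>
  have scale: "(\<integral>x. f (real r * u) x \<partial>lborel) = of_real \<kappa> * (R (Complex 1 u) * exp (- Complex 1 u * of_real (ln W)))" for u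
  proof -
    define w where "w = Complex 1 u"
    have s_w: "s (real r * u) = of_nat r * w"
      by (simp add: s_def w_def Complex_eq algebra_simps)
    moreover have "of_nat r * w / of_nat r = w" using r0 by simp
    ultimately have s_w': "s (real r * u) / of_nat r = w" by simp
    have K_R: "K (of_nat r * w) * Gamma w = of_real \<kappa> * exp (2 * of_nat r * w * of_real (ln (real r))) * R w"
      using meijer_kernel_multiplication[OF r, of a \<alpha> \<nu> w] assms
      unfolding K_def R_def bs_def \<kappa>_def by (simp add: w_def)
    have exps: "exp (2 * of_nat r * w * of_real (ln (real r))) * (exp (- (of_nat r * w) * of_real (ln B - ln \<mu> / real r)) * exp (- w * of_real (ln c)))
       = exp (- w * of_real (ln W))"
      unfolding exp_add[symmetric] lnW using r0
      by (intro arg_cong[where f = exp]) (simp add: field_simps)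
    have "(\<integral>x. f (real r * u) x \<partial>lborel) =
        (K (of_nat r * w) * Gamma w) * (exp (- (of_nat r * w) * of_real (ln B - ln \<mu> / real r)) * exp (- w * of_real (ln c)))"
      unfolding inner_x e_def s_w' unfolding s_w by (simp add: mult_ac)
    also have "\<dots> = of_real \<kappa> * (R w * exp (- w * of_real (ln W)))"
      unfolding K_R exps[symmetric] by (simp add: mult_ac)
    finally show ?thesis by (simp add: w_def)
  qed
  have "of_real (2 * pi) * (\<integral>x. indicator {0<..} x *\<^sub>R (of_real (exp (- c / x) / x) * G x) \<partial>lborel)
      = (\<integral>x. (\<integral>t. f t x \<partial>lborel) \<partial>lborel)"
    unfolding inner_t by (rule Bochner_Integration.integral_mult_right_zero[symmetric])
  also have "\<dots> = (\<integral>t. (\<integral>x. f t x \<partial>lborel) \<partial>lborel)"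
    by (rule lborel_pair.Fubini_integral[OF f_int])
  \<comment> \<open>The Jacobian r of this substitution raises the exponent in \<kappa> by
    one.\<close>
  also have "\<dots> = real r *\<^sub>R (\<integral>u. (\<integral>x. f (real r * u) x \<partial>lborel) \<partial>lborel)"
    using lborel_integral_real_affine[of "real r" "\<lambda>t. \<integral>x. f t x \<partial>lborel" 0] r0 by simp
  also have "\<dots> = real r *\<^sub>R (of_real \<kappa> * (of_real (2 * pi) * GR))"
    unfolding scale GR by simp
  also have "\<dots> = of_real (2 * pi) * (of_real (real r * \<kappa>) * GR)"
    by (simp add: scaleR_conv_of_real)
  also have "real r * \<kappa> = real r powr (\<alpha> + \<nu> - 1) / (2 * pi) ^ (r - 1)"
    using r0 powr_add[of "real r" "\<alpha> + \<nu> - 2" 1] by (simp add: \<kappa>_def)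
  finally have "(\<integral>x. indicator {0<..} x *\<^sub>R (of_real (exp (- c / x) / x) * G x) \<partial>lborel)
      = of_real (real r powr (\<alpha> + \<nu> - 1) / (2 * pi) ^ (r - 1)) * GR"
    by (simp only: mult_cancel_left) simp
  moreover have "integrable lborel (\<lambda>x. indicator {0<..} x *\<^sub>R (of_real (exp (- c / x) / x) * G x))"
  proof -
    define g where "g x = indicator {0<..} x *\<^sub>R (of_real (exp (- c / x) / x) * G x)" for x :: real
    have "integrable lborel (\<lambda>x. of_real (2 * pi) * g x)"
      using lborel_pair.integrable_snd[OF f_int] unfolding inner_t g_def .
    then have "integrable lborel (\<lambda>x. of_real (1 / (2 * pi)) * (of_real (2 * pi) * g x))"
      by (rule integrable_mult_right)
    then show ?thesis unfolding g_def[symmetric] by simp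
  qed
  ultimately show "has_bochner_integral lborel (\<lambda>x. indicator {0<..} x *\<^sub>R (of_real (exp (- c / x) / x) * G x))
     (of_real (real r powr (\<alpha> + \<nu> - 1) / (2 * pi) ^ (r - 1)) *
       meijer_G (3 * r + 1) 0 (map complex_of_real (Delta r (a + 1)))
         (map complex_of_real (Delta r a @ Delta r \<alpha> @ Delta r \<nu> @ [0]))
         (complex_of_real (c / \<mu> * (B / (real r)\<^sup>2) ^ r)))"
    unfolding has_bochner_integral_iff GR_def bs_def W_def by blast
  show "meijer_G (3 * r + 1) 0 (map complex_of_real (Delta r (a + 1)))
         (map complex_of_real (Delta r a @ Delta r \<alpha> @ Delta r \<nu> @ [0]))
         (complex_of_real (c / \<mu> * (B / (real r)\<^sup>2) ^ r)) \<in> \<real>"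
    using GR_real unfolding GR_def bs_def W_def .
qed

section \<open>Outage probability\<close>

text \<open>By independence the joint law is a product measure, and the section of the event at
  \<open>Y = y\<close> is the ray above \<open>h y\<close>.\<close>

lemma (in prob_space) prob_greater_of_indep:
  fixes X Y :: "'a \<Rightarrow> real" and h :: "real \<Rightarrow> real"
  assumes ind: "indep_var borel X borel Y" and [measurable]: "h \<in> borel_measurable borel"
  shows "prob {\<omega> \<in> space M. h (Y \<omega>) < X \<omega>} = expectation (\<lambda>\<omega>. measure (distr M borel X) {h (Y \<omega>)<..})"
proof -
  have [measurable]: "X \<in> borel_measurable M" "Y \<in> borel_measurable M"
    and eq: "distr M borel X \<Otimes>\<^sub>M distr M borel Y = distr M (borel \<Otimes>\<^sub>M borel) (\<lambda>\<omega>. (X \<omega>, Y \<omega>))"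
    using ind unfolding indep_var_distribution_eq by auto
  interpret D1: prob_space "distr M borel X" by (rule prob_space_distr) measurable
  interpret D2: prob_space "distr M borel Y" by (rule prob_space_distr) measurable
  interpret pair_sigma_finite "distr M borel X" "distr M borel Y" ..
  let ?Q = "{p \<in> space (borel \<Otimes>\<^sub>M borel). h (snd p) < fst p}"
  have Q [measurable]: "?Q \<in> sets (borel \<Otimes>\<^sub>M borel)"
    by (rule borel_measurable_less) (auto intro!: measurable_compose[OF measurable_snd])
  then have Q': "?Q \<in> sets (distr M borel X \<Otimes>\<^sub>M distr M borel Y)"
    by (subst sets_pair_measure_cong[OF sets_distr sets_distr])
  have "emeasure M {\<omega> \<in> space M. h (Y \<omega>) < X \<omega>} = emeasure (distr M (borel \<Otimes>\<^sub>M borel) (\<lambda>\<omega>. (X \<omega>, Y \<omega>))) ?Q"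
    by (subst emeasure_distr[OF _ Q]) (measurable, auto intro!: arg_cong[where f = "emeasure M"] simp: space_pair_measure)
  also have "\<dots> = (\<integral>\<^sup>+y. emeasure (distr M borel X) ((\<lambda>x. (x, y)) -` ?Q) \<partial>distr M borel Y)"
    unfolding eq[symmetric] by (rule emeasure_pair_measure_alt2[OF Q'])
  finally have emeasure_eq: "emeasure M {\<omega> \<in> space M. h (Y \<omega>) < X \<omega>}
      = (\<integral>\<^sup>+y. emeasure (distr M borel X) ((\<lambda>x. (x, y)) -` ?Q) \<partial>distr M borel Y)" .
  have Q_section: "(\<lambda>x. (x, y)) -` ?Q = {h y<..}" for y
    by (auto simp: space_pair_measure)
  have meas [measurable]: "(\<lambda>y. measure (distr M borel X) {h y<..}) \<in> borel_measurable borel"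
  proof -
    have "(\<lambda>y. emeasure (distr M borel X) ((\<lambda>x. (x, y)) -` ?Q)) \<in> borel_measurable (distr M borel Y)"
      by (rule measurable_emeasure_Pair2[OF Q'])
    then have "(\<lambda>y. emeasure (distr M borel X) {h y<..}) \<in> borel_measurable borel"
      unfolding Q_section measurable_distr_eq1 .
    then show ?thesis unfolding measure_def by measurable
  qed
  note emeasure_eq
  also have "(\<integral>\<^sup>+y. emeasure (distr M borel X) ((\<lambda>x. (x, y)) -` ?Q) \<partial>distr M borel Y)
      = (\<integral>\<^sup>+y. ennreal (measure (distr M borel X) {h y<..}) \<partial>distr M borel Y)"
    by (simp only: Q_section D1.emeasure_eq_measure)
  also have "\<dots> = (\<integral>\<^sup>+\<omega>. ennreal (measure (distr M borel X) {h (Y \<omega>)<..}) \<partial>M)"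
    by (subst nn_integral_distr) auto
  also have "\<dots> = ennreal (expectation (\<lambda>\<omega>. measure (distr M borel X) {h (Y \<omega>)<..}))"
    by (intro nn_integral_eq_integral integrable_const_bound[where B = 1]) (auto intro!: always_eventually)
  finally show ?thesis
    by (simp add: emeasure_eq_measure integral_nonneg_AE)
qed

lemma has_bochner_integral_exp_tail:
  fixes l x :: real
  assumes "0 < l"
  shows "has_bochner_integral lborel (\<lambda>y. indicator {x<..} y * exp (- l * y)) (exp (- l * x) / l)"
proof -
  have "(\<integral>\<^sup>+y. ennreal (indicator {x..} y * exp (- l * y)) \<partial>lborel) = ennreal (exp (- l * x) / l)"
    using has_integral_exp_minus_to_infinity[OF assms, of x] by (intro nn_integral_has_integral_lebesgue) auto
  then have "has_bochner_integral lborel (\<lambda>y. indicator {x..} y * exp (- l * y)) (exp (- l * x) / l)"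
    using assms by (intro has_bochner_integral_nn_integral) auto
  \<comment> \<open>The known integral is over the closed ray; the end point is a null set.\<close>
  moreover have "AE y in lborel. indicator {x..} y * exp (- l * y) = indicator {x<..} y * exp (- l * y)"
    using AE_lborel_singleton[of x] by eventually_elim (auto simp: indicator_def)
  ultimately show ?thesis
    by (subst (asm) has_bochner_integral_cong_AE) auto
qed

text \<open>Integrating term k divides its weight by the rate \<open>l k\<close>, and
  \<open>D k * l k = M - m + k + 1\<close>, so \<open>\<mu>\<^sub>1\<close> and \<rho> survive only
  in the exponent.\<close>

lemma rf_tail:
  assumes "prob_space P" "1 \<le> m" "m \<le> M" "\<rho> \<le> 1" "0 < \<mu>\<^sub>1" "0 \<le> x"
    and dens: "has_density P X (rf_density M m \<rho> \<mu>\<^sub>1)"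
  shows "measure (distr P borel X) {x<..} = real m * real (M choose m) *
     (\<Sum>k<m. (- 1) ^ k * real ((m - 1) choose k) / real (M - m + k + 1) *
        exp (- (real (M - m + k + 1) / ((real (M - m + k) * (1 - \<rho>) + 1) * \<mu>\<^sub>1) * x)))"
proof -
  let ?f = "rf_density M m \<rho> \<mu>\<^sub>1"
  define D where "D k = (real (M - m + k) * (1 - \<rho>) + 1) * \<mu>\<^sub>1" for k
  define l where "l k = real (M - m + k + 1) / D k" for k
  let ?S = "real m * real (M choose m) *
     (\<Sum>k<m. (- 1) ^ k * real ((m - 1) choose k) / real (M - m + k + 1) * exp (- (l k * x)))"
  have D: "0 < D k" for k
    using assms by (auto simp: D_def intro!: mult_pos_pos add_nonneg_pos)
  have l: "0 < l k" for k using D by (simp add: l_def)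
  have distr: "distributed P lborel X (\<lambda>x. ennreal (?f x))" and nonneg: "AE x in lborel. 0 \<le> ?f x"
    using dens by (auto simp: has_density_def)
  have "has_bochner_integral lborel (\<lambda>y. real m * real (M choose m) *
      (\<Sum>k<m. ((- 1) ^ k * real ((m - 1) choose k) / D k) * (indicator {x<..} y * exp (- l k * y))))
     (real m * real (M choose m) * (\<Sum>k<m. ((- 1) ^ k * real ((m - 1) choose k) / D k) * (exp (- l k * x) / l k)))"
    by (intro has_bochner_integral_mult_right has_bochner_integral_sum has_bochner_integral_exp_tail l)
  also have "(\<lambda>y. real m * real (M choose m) *
      (\<Sum>k<m. ((- 1) ^ k * real ((m - 1) choose k) / D k) * (indicator {x<..} y * exp (- l k * y))))
      = (\<lambda>y. indicator {x<..} y * ?f y)"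
    using \<open>0 \<le> x\<close> by (auto simp: fun_eq_iff rf_density_def indicator_def l_def D_def)
  also have "(real m * real (M choose m) * (\<Sum>k<m. ((- 1) ^ k * real ((m - 1) choose k) / D k) * (exp (- l k * x) / l k))) = ?S"
  proof -
    have "u / D k * (E / l k) = u / real (M - m + k + 1) * E" for u E k
    proof -
      have "D k * l k = real (M - m + k + 1)" using D[of k] by (simp add: l_def)
      moreover have "u / D k * (E / l k) = u * E / (D k * l k)" by simp
      ultimately show ?thesis by simp
    qed
    then show ?thesis by (simp only: minus_mult_left)
  qed
  finally have hb: "has_bochner_integral lborel (\<lambda>y. indicator {x<..} y * ?f y) ?S" .
  have "emeasure (distr P borel X) {x<..} = emeasure (distr P lborel X) {x<..}"
    by (simp add: distr_cong[OF refl sets_lborel])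
  also have "\<dots> = (\<integral>\<^sup>+y. ennreal (?f y) * indicator {x<..} y \<partial>lborel)"
    using distr by (subst distributed_distr_eq_density[OF distr]) (auto simp: emeasure_density distributed_def)
  also have "\<dots> = (\<integral>\<^sup>+y. ennreal (indicator {x<..} y * ?f y) \<partial>lborel)"
    by (intro nn_integral_cong) (auto simp: indicator_def)
  also have "\<dots> = ennreal ?S"
    using hb nonneg by (subst nn_integral_eq_integral) (auto simp: has_bochner_integral_iff)
  finally have "emeasure (distr P borel X) {x<..} = ennreal ?S" .
  \<comment> \<open>The sum alternates, so its sign is not visible from the formula; it is needed to
    get from the \<open>ennreal\<close> value back to a real one.\<close>
  moreover have "0 \<le> ?S"
  proof -
    have "0 \<le> (\<integral>y. indicator {x<..} y * ?f y \<partial>lborel)"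
      using nonneg by (intro integral_nonneg_AE) auto
    then show ?thesis using has_bochner_integral_integral_eq[OF hb] by simp
  qed
  ultimately show ?thesis
    unfolding D_def l_def by (simp add: measure_def)
qed

text \<open>\<open>has_density\<close> gives measurability of f only after the cast to
  \<open>ennreal\<close>. The density is therefore replaced by
  \<open>enn2real (ennreal (f x))\<close>, which is measurable and agrees with f almost
  everywhere.\<close>

lemma expectation_of_has_density:
  assumes "prob_space P" and dens: "has_density P X f" and [measurable]: "g \<in> borel_measurable borel"
    and hb: "has_bochner_integral lborel (\<lambda>x. f x * g x) I"
  shows "prob_space.expectation P (\<lambda>\<omega>. g (X \<omega>)) = (I::real)"
proof -
  have distr: "distributed P lborel X (\<lambda>x. ennreal (f x))" and nonneg: "AE x in lborel. 0 \<le> f x"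
    using dens by (auto simp: has_density_def)
  let ?f = "\<lambda>x. enn2real (ennreal (f x))"
  have [measurable]: "(\<lambda>x. ennreal (f x)) \<in> borel_measurable lborel"
    using distr by (simp add: distributed_def)
  have "distributed P lborel X (\<lambda>x. ennreal (?f x))"
    using distr by (simp add: ennreal_enn2real_if)
  then have "(\<integral>x. ?f x * g x \<partial>lborel) = (\<integral>\<omega>. g (X \<omega>) \<partial>P)"
    by (intro distributed_integral) auto
  moreover have "(\<integral>x. ?f x * g x \<partial>lborel) = (\<integral>x. f x * g x \<partial>lborel)"
  proof (rule integral_cong_AE)
    show "(\<lambda>x. f x * g x) \<in> borel_measurable lborel"
      using hb by (auto simp: has_bochner_integral_iff)
    show "AE x in lborel. ?f x * g x = f x * g x"
      using nonneg by eventually_elim simp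
  qed measurable
  ultimately show ?thesis using has_bochner_integral_integral_eq[OF hb] by simp
qed

lemma expectation_exp_inverse_optical:
  assumes "prob_space P" and r: "r \<in> {1, 2}" and pos: "0 < \<mu>" "0 < \<xi>" "0 < \<alpha>" "0 < B" "0 < c"
    and dens: "has_density P Y (optical_density r \<mu> \<xi> \<alpha> \<beta> g \<Omega>' B)"
  shows "complex_of_real (prob_space.expectation P (\<lambda>\<omega>. exp (- c / Y \<omega>))) =
    of_real (\<xi>\<^sup>2 * malaga_A \<alpha> \<beta> g \<Omega>' / 2 ^ r) *
    (\<Sum>n=1..\<beta>. of_real (malaga_b \<alpha> \<beta> g \<Omega>' n) * (of_real (real r powr (\<alpha> + real n - 1) / (2 * pi) ^ (r - 1)) *
       meijer_G (3 * r + 1) 0 (map complex_of_real (Delta r (\<xi>\<^sup>2 + 1)))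
         (map complex_of_real (Delta r (\<xi>\<^sup>2) @ Delta r \<alpha> @ Delta r (real n) @ [0]))
         (complex_of_real (c / \<mu> * (B / (real r)\<^sup>2) ^ r))))"
proof -
  define G where "G n x = meijer_G 3 0 (map complex_of_real [\<xi>\<^sup>2 + 1]) (map complex_of_real [\<xi>\<^sup>2, \<alpha>, real n])
    (complex_of_real (B * (x / \<mu>) powr (1 / real r)))" for n x
  define V where "V n = of_real (real r powr (\<alpha> + real n - 1) / (2 * pi) ^ (r - 1)) *
       meijer_G (3 * r + 1) 0 (map complex_of_real (Delta r (\<xi>\<^sup>2 + 1)))
         (map complex_of_real (Delta r (\<xi>\<^sup>2) @ Delta r \<alpha> @ Delta r (real n) @ [0]))
         (complex_of_real (c / \<mu> * (B / (real r)\<^sup>2) ^ r))" for n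
  define k where "k = \<xi>\<^sup>2 * malaga_A \<alpha> \<beta> g \<Omega>' / 2 ^ r"
  define b where "b = malaga_b \<alpha> \<beta> g \<Omega>'"
  define T where "T n x = Re (indicator {0<..} x *\<^sub>R (of_real (exp (- c / x) / x) * G n x))" for n x
  have T: "has_bochner_integral lborel (T n) (Re (V n))" and V: "of_real (Re (V n)) = V n" if "n \<in> {1..\<beta>}" for n
  proof -
    have "0 < \<xi>\<^sup>2" "0 < real n" using pos that by auto
    note moment = meijer_G_inverse_moment[OF r this(1) pos(3) this(2) pos(4) pos(1) pos(5)]
    show "has_bochner_integral lborel (T n) (Re (V n))"
      unfolding T_def V_def G_def by (rule has_bochner_integral_Re[OF moment(1)])
    have "V n \<in> \<real>" unfolding V_def by (intro Reals_mult Reals_of_real moment(2))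
    then show "of_real (Re (V n)) = V n" by simp
  qed
  have "has_bochner_integral lborel (\<lambda>x. k * (\<Sum>n=1..\<beta>. b n * T n x)) (k * (\<Sum>n=1..\<beta>. b n * Re (V n)))"
    by (intro has_bochner_integral_mult_right has_bochner_integral_sum T)
  also have "(\<lambda>x. k * (\<Sum>n=1..\<beta>. b n * T n x)) = (\<lambda>x. optical_density r \<mu> \<xi> \<alpha> \<beta> g \<Omega>' B x * exp (- c / x))"
  proof
    fix x :: real
    show "k * (\<Sum>n=1..\<beta>. b n * T n x) = optical_density r \<mu> \<xi> \<alpha> \<beta> g \<Omega>' B x * exp (- c / x)"
    proof (cases "0 < x")
      case True
      then have "T n x = exp (- c / x) / x * Re (G n x)" for n by (simp add: T_def)
      then have "k * (\<Sum>n=1..\<beta>. b n * T n x) = k / x * (\<Sum>n=1..\<beta>. b n * Re (G n x)) * exp (- c / x)"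
        by (simp add: sum_distrib_left sum_distrib_right mult_ac)
      then show ?thesis
        using True unfolding optical_density_def G_def k_def b_def by simp
    qed (simp add: T_def optical_density_def)
  qed
  finally have "prob_space.expectation P (\<lambda>\<omega>. exp (- c / Y \<omega>)) = k * (\<Sum>n=1..\<beta>. b n * Re (V n))"
    by (intro expectation_of_has_density[OF \<open>prob_space P\<close> dens]) measurable
  then have "complex_of_real (prob_space.expectation P (\<lambda>\<omega>. exp (- c / Y \<omega>))) = of_real k * (\<Sum>n=1..\<beta>. of_real (b n) * V n)"
    using V by simp
  then show ?thesis unfolding k_def b_def V_def .
qed

theorem mainTheorem3:
  fixes P :: "'a measure"
    and \<gamma>\<^sub>1 \<gamma>\<^sub>2 \<gamma> :: "'a \<Rightarrow> real"
    and M m r \<beta> :: nat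
    and \<rho> \<mu>\<^sub>1 \<mu>\<^sub>r \<xi> \<alpha> g \<Omega>' B \<kappa>\<^sub>1 \<kappa>\<^sub>2 \<delta> C \<gamma>\<^sub>t\<^sub>h A :: real
    and b \<zeta>\<^sub>1 \<zeta>\<^sub>2 :: "nat \<Rightarrow> real"
    and \<tau>\<^sub>4 :: "nat \<Rightarrow> real list"
    and \<tau>\<^sub>5 :: "real list"
  assumes "prob_space P"
    and "1 \<le> m" and "m \<le> M" and "0 \<le> \<rho>" and "\<rho> \<le> 1" and "0 < \<mu>\<^sub>1"
    and "r \<in> {1, 2}" and "0 < \<mu>\<^sub>r" and "0 < \<xi>" and "0 < \<alpha>" and "1 \<le> \<beta>"
    and "0 < g" and "0 < \<Omega>'" and "0 < B"
    and "0 \<le> \<kappa>\<^sub>1" and "0 \<le> \<kappa>\<^sub>2" and "0 < \<gamma>\<^sub>t\<^sub>h"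
    and "\<forall>\<omega>\<in>space P. 0 \<le> \<gamma>\<^sub>1 \<omega>"
    and "\<forall>\<omega>\<in>space P. 0 < \<gamma>\<^sub>2 \<omega>"
    and "has_density P \<gamma>\<^sub>1 (rf_density M m \<rho> \<mu>\<^sub>1)"
    and "has_density P \<gamma>\<^sub>2 (optical_density r \<mu>\<^sub>r \<xi> \<alpha> \<beta> g \<Omega>' B)"
    and "prob_space.indep_var P borel \<gamma>\<^sub>1 borel \<gamma>\<^sub>2"
    and "A = malaga_A \<alpha> \<beta> g \<Omega>'"
    and "b = malaga_b \<alpha> \<beta> g \<Omega>'"
    and "\<delta> = \<kappa>\<^sub>1\<^sup>2 + \<kappa>\<^sub>2\<^sup>2 + \<kappa>\<^sub>1\<^sup>2 * \<kappa>\<^sub>2\<^sup>2"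
    and "C = prob_space.expectation P \<gamma>\<^sub>1 * (1 + \<kappa>\<^sub>1\<^sup>2) + 1"
    and "\<gamma> = (\<lambda>\<omega>. \<gamma>\<^sub>1 \<omega> * \<gamma>\<^sub>2 \<omega> /
               (\<delta> * \<gamma>\<^sub>1 \<omega> * \<gamma>\<^sub>2 \<omega> + (1 + \<kappa>\<^sub>2\<^sup>2) * \<gamma>\<^sub>2 \<omega> + C))"
    and "\<tau>\<^sub>5 = Delta r (\<xi>\<^sup>2 + 1)"
    and "\<tau>\<^sub>4 = (\<lambda>n. Delta r (\<xi>\<^sup>2) @ Delta r \<alpha> @ Delta r (real n) @ [0])"
    and "\<zeta>\<^sub>1 = (\<lambda>k. real (M - m + k + 1) * (1 + \<kappa>\<^sub>2\<^sup>2) /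
               ((real (M - m + k) * (1 - \<rho>) + 1) * (1 - \<delta> * \<gamma>\<^sub>t\<^sub>h)))"
    and "\<zeta>\<^sub>2 = (\<lambda>k. real (M - m + k + 1) * C /
               ((real (M - m + k) * (1 - \<rho>) + 1) * (1 - \<delta> * \<gamma>\<^sub>t\<^sub>h)) * (B / (real r)\<^sup>2) ^ r)"
  shows "(1 - \<delta> * \<gamma>\<^sub>t\<^sub>h > 0 \<longrightarrow>
            complex_of_real (prob_space.prob P {\<omega> \<in> space P. \<gamma> \<omega> \<le> \<gamma>\<^sub>t\<^sub>h}) =
              1 - complex_of_real
                    (real m * \<xi>\<^sup>2 * A / (2 ^ r * (2 * pi) ^ (r - 1)) * real (M choose m)) *
                  (\<Sum>k<m. \<Sum>n=1..\<beta>.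
                     complex_of_real
                       (real ((m - 1) choose k) * exp (- \<zeta>\<^sub>1 k * \<gamma>\<^sub>t\<^sub>h / \<mu>\<^sub>1) *
                        ((- 1) ^ k * b n * real r powr (\<alpha> + real n - 1) / real (M - m + k + 1))) *
                     meijer_G (3 * r + 1) 0
                       (map complex_of_real \<tau>\<^sub>5) (map complex_of_real (\<tau>\<^sub>4 n))
                       (complex_of_real (\<zeta>\<^sub>2 k * \<gamma>\<^sub>t\<^sub>h / (\<mu>\<^sub>1 * \<mu>\<^sub>r))))) \<and>
         (\<not> 1 - \<delta> * \<gamma>\<^sub>t\<^sub>h > 0 \<longrightarrow>
            prob_space.prob P {\<omega> \<in> space P. \<gamma> \<omega> \<le> \<gamma>\<^sub>t\<^sub>h} = 1)"
proof -
  interpret prob_space P by fact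
  have m: "1 \<le> m" "m \<le> M" and \<rho>: "\<rho> \<le> 1" and \<mu>: "0 < \<mu>\<^sub>1" "0 < \<mu>\<^sub>r" and r: "r \<in> {1, 2}"
    and opt: "0 < \<xi>" "0 < \<alpha>" "0 < B" and th: "0 < \<gamma>\<^sub>t\<^sub>h"
    and g1: "\<And>\<omega>. \<omega> \<in> space P \<Longrightarrow> 0 \<le> \<gamma>\<^sub>1 \<omega>" and g2: "\<And>\<omega>. \<omega> \<in> space P \<Longrightarrow> 0 < \<gamma>\<^sub>2 \<omega>"
    and dens: "has_density P \<gamma>\<^sub>1 (rf_density M m \<rho> \<mu>\<^sub>1)" "has_density P \<gamma>\<^sub>2 (optical_density r \<mu>\<^sub>r \<xi> \<alpha> \<beta> g \<Omega>' B)"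
    and ind: "indep_var borel \<gamma>\<^sub>1 borel \<gamma>\<^sub>2"
    using assms by auto
  have \<delta>: "0 \<le> \<delta>" using assms by simp
  have "0 \<le> expectation \<gamma>\<^sub>1" using g1 by (intro integral_nonneg_AE AE_I2)
  then have C: "0 < C" using assms by (simp add: add_nonneg_pos)
  have [measurable]: "\<gamma>\<^sub>1 \<in> borel_measurable P" "\<gamma>\<^sub>2 \<in> borel_measurable P"
    using ind unfolding indep_var_distribution_eq by auto
  \<comment> \<open>Positivity of the denominator of \<gamma> allows it to be cleared; collecting
    the \<delta> terms brings out the sign on which the two cases depend.\<close>
  have iff: "\<gamma> \<omega> \<le> \<gamma>\<^sub>t\<^sub>h \<longleftrightarrow> \<gamma>\<^sub>1 \<omega> * \<gamma>\<^sub>2 \<omega> * (1 - \<delta> * \<gamma>\<^sub>t\<^sub>h) \<le> \<gamma>\<^sub>t\<^sub>h * ((1 + \<kappa>\<^sub>2\<^sup>2) * \<gamma>\<^sub>2 \<omega> + C)"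
    if "\<omega> \<in> space P" for \<omega>
  proof -
    have "0 < \<delta> * \<gamma>\<^sub>1 \<omega> * \<gamma>\<^sub>2 \<omega> + (1 + \<kappa>\<^sub>2\<^sup>2) * \<gamma>\<^sub>2 \<omega> + C"
      using g1[OF that] g2[OF that] \<delta> C by (intro add_nonneg_pos add_nonneg_nonneg mult_nonneg_nonneg) auto
    then show ?thesis
      unfolding \<open>\<gamma> = _\<close> by (simp add: pos_divide_le_eq algebra_simps)
  qed
  show ?thesis
  proof (intro conjI impI)
    assume "\<not> 0 < 1 - \<delta> * \<gamma>\<^sub>t\<^sub>h"
    then have neg: "1 - \<delta> * \<gamma>\<^sub>t\<^sub>h \<le> 0" by simp
    \<comment> \<open>Here \<delta> is positive and the threshold is at least
      \<open>1 / delta\<close>, the ceiling that distortion imposes on \<gamma>.\<close>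
    have "{\<omega> \<in> space P. \<gamma> \<omega> \<le> \<gamma>\<^sub>t\<^sub>h} = space P"
    proof (intro equalityI subsetI CollectI conjI)
      fix \<omega> assume \<omega>: "\<omega> \<in> space P"
      have "\<gamma>\<^sub>1 \<omega> * \<gamma>\<^sub>2 \<omega> * (1 - \<delta> * \<gamma>\<^sub>t\<^sub>h) \<le> 0"
        using g1[OF \<omega>] g2[OF \<omega>] neg by (intro mult_nonneg_nonpos) auto
      also have "0 \<le> \<gamma>\<^sub>t\<^sub>h * ((1 + \<kappa>\<^sub>2\<^sup>2) * \<gamma>\<^sub>2 \<omega> + C)"
        using g2[OF \<omega>] C th by (intro mult_nonneg_nonneg add_nonneg_nonneg) auto
      finally show "\<gamma> \<omega> \<le> \<gamma>\<^sub>t\<^sub>h" using iff[OF \<omega>] by simp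
    qed auto
    then show "prob {\<omega> \<in> space P. \<gamma> \<omega> \<le> \<gamma>\<^sub>t\<^sub>h} = 1" by (simp add: prob_space)
  next
    assume q: "0 < 1 - \<delta> * \<gamma>\<^sub>t\<^sub>h"
    \<comment> \<open>Given that the optical SNR is y, outage is avoided exactly when the RF SNR
      exceeds \<open>h y\<close>.\<close>
    define h where "h y = \<gamma>\<^sub>t\<^sub>h / (1 - \<delta> * \<gamma>\<^sub>t\<^sub>h) * ((1 + \<kappa>\<^sub>2\<^sup>2) + C / y)" for y
    have [measurable]: "h \<in> borel_measurable borel" unfolding h_def[abs_def] by measurable
    define l where "l k = real (M - m + k + 1) / ((real (M - m + k) * (1 - \<rho>) + 1) * \<mu>\<^sub>1)" for k
    have l: "0 < l k" for k
      using \<rho> \<mu> unfolding l_def by (intro divide_pos_pos mult_pos_pos add_nonneg_pos mult_nonneg_nonneg) auto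
    define c where "c k = l k * (\<gamma>\<^sub>t\<^sub>h / (1 - \<delta> * \<gamma>\<^sub>t\<^sub>h)) * C" for k
    have c: "0 < c k" for k unfolding c_def using l th q C by simp
    define w where "w k = (- 1) ^ k * real ((m - 1) choose k) / real (M - m + k + 1)" for k
    \<comment> \<open>The part of \<open>h y\<close> free of y produces
      \<open>\<zeta>\<^sub>1\<close>; the part \<open>C / y\<close> produces the inverse exponential
      moment with parameter \<open>c k\<close>.\<close>
    have exp_split: "exp (- (l k * h y)) = exp (- \<zeta>\<^sub>1 k * \<gamma>\<^sub>t\<^sub>h / \<mu>\<^sub>1) * exp (- c k / y)" for k y
    proof -
      have "l k * h y = \<zeta>\<^sub>1 k * \<gamma>\<^sub>t\<^sub>h / \<mu>\<^sub>1 + c k / y"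
      proof -
        have "N / (d * u) * (t / q * (e + C / y)) = N * e / (d * q) * t / u + (N / (d * u) * (t / q) * C) / y"
          for N d u t q e :: real
          by (simp add: distrib_left mult_ac)
        then show ?thesis unfolding \<open>\<zeta>\<^sub>1 = _\<close> l_def h_def c_def .
      qed
      then show ?thesis by (simp flip: exp_add)
    qed
    have event: "\<gamma> \<omega> \<le> \<gamma>\<^sub>t\<^sub>h \<longleftrightarrow> \<not> h (\<gamma>\<^sub>2 \<omega>) < \<gamma>\<^sub>1 \<omega>" if \<omega>: "\<omega> \<in> space P" for \<omega>
    proof -
      have "h (\<gamma>\<^sub>2 \<omega>) * (\<gamma>\<^sub>2 \<omega> * (1 - \<delta> * \<gamma>\<^sub>t\<^sub>h)) = \<gamma>\<^sub>t\<^sub>h * ((1 + \<kappa>\<^sub>2\<^sup>2) * \<gamma>\<^sub>2 \<omega> + C)"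
        using q g2[OF \<omega>] unfolding h_def by (simp add: field_simps)
      moreover have "0 < \<gamma>\<^sub>2 \<omega> * (1 - \<delta> * \<gamma>\<^sub>t\<^sub>h)" using q g2[OF \<omega>] by simp
      ultimately show ?thesis
        unfolding iff[OF \<omega>] not_less by (metis mult.assoc mult_le_cancel_right_pos)
    qed
    have h_nonneg: "0 \<le> h (\<gamma>\<^sub>2 \<omega>)" if \<omega>: "\<omega> \<in> space P" for \<omega>
      using q th C g2[OF \<omega>] unfolding h_def by (intro mult_nonneg_nonneg add_nonneg_nonneg) auto
    have "{\<omega> \<in> space P. \<gamma> \<omega> \<le> \<gamma>\<^sub>t\<^sub>h} = space P - {\<omega> \<in> space P. h (\<gamma>\<^sub>2 \<omega>) < \<gamma>\<^sub>1 \<omega>}"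
      using event by auto
    then have "prob {\<omega> \<in> space P. \<gamma> \<omega> \<le> \<gamma>\<^sub>t\<^sub>h} = 1 - prob {\<omega> \<in> space P. h (\<gamma>\<^sub>2 \<omega>) < \<gamma>\<^sub>1 \<omega>}"
      by (simp add: prob_compl)
    also have "prob {\<omega> \<in> space P. h (\<gamma>\<^sub>2 \<omega>) < \<gamma>\<^sub>1 \<omega>}
        = expectation (\<lambda>\<omega>. measure (distr P borel \<gamma>\<^sub>1) {h (\<gamma>\<^sub>2 \<omega>)<..})"
      by (intro prob_greater_of_indep ind) measurable
    also have "\<dots> = expectation (\<lambda>\<omega>. real m * real (M choose m) *
        (\<Sum>k<m. w k * exp (- \<zeta>\<^sub>1 k * \<gamma>\<^sub>t\<^sub>h / \<mu>\<^sub>1) * exp (- c k / \<gamma>\<^sub>2 \<omega>)))"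
      using rf_tail[OF \<open>prob_space P\<close> m \<rho> \<mu>(1) h_nonneg dens(1)]
      by (intro Bochner_Integration.integral_cong refl)
        (simp only: l_def[symmetric] w_def[symmetric] exp_split mult.assoc)
    also have "\<dots> = real m * real (M choose m) *
        (\<Sum>k<m. w k * exp (- \<zeta>\<^sub>1 k * \<gamma>\<^sub>t\<^sub>h / \<mu>\<^sub>1) * expectation (\<lambda>\<omega>. exp (- c k / \<gamma>\<^sub>2 \<omega>)))"
    proof -
      have "integrable P (\<lambda>\<omega>. exp (- c k / \<gamma>\<^sub>2 \<omega>))" for k
      proof (rule integrable_const_bound[where B = 1])
        show "AE \<omega> in P. norm (exp (- c k / \<gamma>\<^sub>2 \<omega>)) \<le> 1"
        proof (rule AE_I2)
          fix \<omega> assume "\<omega> \<in> space P"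
          then show "norm (exp (- c k / \<gamma>\<^sub>2 \<omega>)) \<le> 1"
            using g2[of \<omega>] c[of k] by simp
        qed
      qed measurable
      then show ?thesis by (simp add: Bochner_Integration.integral_sum)
    qed
    finally have P_out: "prob {\<omega> \<in> space P. \<gamma> \<omega> \<le> \<gamma>\<^sub>t\<^sub>h} = 1 - real m * real (M choose m) *
        (\<Sum>k<m. w k * exp (- \<zeta>\<^sub>1 k * \<gamma>\<^sub>t\<^sub>h / \<mu>\<^sub>1) * expectation (\<lambda>\<omega>. exp (- c k / \<gamma>\<^sub>2 \<omega>)))" .
    define G where "G k n = meijer_G (3 * r + 1) 0 (map complex_of_real \<tau>\<^sub>5) (map complex_of_real (\<tau>\<^sub>4 n))
        (complex_of_real (\<zeta>\<^sub>2 k * \<gamma>\<^sub>t\<^sub>h / (\<mu>\<^sub>1 * \<mu>\<^sub>r)))" for k n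
    have arg: "c k / \<mu>\<^sub>r * (B / (real r)\<^sup>2) ^ r = \<zeta>\<^sub>2 k * \<gamma>\<^sub>t\<^sub>h / (\<mu>\<^sub>1 * \<mu>\<^sub>r)" for k
      unfolding \<open>\<zeta>\<^sub>2 = _\<close> c_def l_def by (simp add: mult_ac)
    have moment: "complex_of_real (expectation (\<lambda>\<omega>. exp (- c k / \<gamma>\<^sub>2 \<omega>))) =
        of_real (\<xi>\<^sup>2 * A / 2 ^ r) * (\<Sum>n=1..\<beta>. of_real (b n) *
          (of_real (real r powr (\<alpha> + real n - 1) / (2 * pi) ^ (r - 1)) * G k n))" for k
      using expectation_exp_inverse_optical[OF \<open>prob_space P\<close> r \<mu>(2) opt c dens(2), of k]
      unfolding arg G_def \<open>A = _\<close> \<open>b = _\<close> \<open>\<tau>\<^sub>5 = _\<close> \<open>\<tau>\<^sub>4 = _\<close> .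
    have "complex_of_real (prob {\<omega> \<in> space P. \<gamma> \<omega> \<le> \<gamma>\<^sub>t\<^sub>h}) = 1 - of_real (real m * real (M choose m)) *
        (\<Sum>k<m. of_real (w k * exp (- \<zeta>\<^sub>1 k * \<gamma>\<^sub>t\<^sub>h / \<mu>\<^sub>1)) *
          (of_real (\<xi>\<^sup>2 * A / 2 ^ r) * (\<Sum>n=1..\<beta>. of_real (b n) *
            (of_real (real r powr (\<alpha> + real n - 1) / (2 * pi) ^ (r - 1)) * G k n))))"
      unfolding P_out moment[symmetric] by simp
    also have "of_real (real m * real (M choose m)) *
        (\<Sum>k<m. of_real (w k * exp (- \<zeta>\<^sub>1 k * \<gamma>\<^sub>t\<^sub>h / \<mu>\<^sub>1)) *
          (of_real (\<xi>\<^sup>2 * A / 2 ^ r) * (\<Sum>n=1..\<beta>. of_real (b n) *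
            (of_real (real r powr (\<alpha> + real n - 1) / (2 * pi) ^ (r - 1)) * G k n)))) =
        of_real (real m * \<xi>\<^sup>2 * A / (2 ^ r * (2 * pi) ^ (r - 1)) * real (M choose m)) *
        (\<Sum>k<m. \<Sum>n=1..\<beta>. of_real (real ((m - 1) choose k) * exp (- \<zeta>\<^sub>1 k * \<gamma>\<^sub>t\<^sub>h / \<mu>\<^sub>1) *
          ((- 1) ^ k * b n * real r powr (\<alpha> + real n - 1) / real (M - m + k + 1))) * G k n)"
      unfolding sum_distrib_left
    proof (intro sum.cong refl)
      fix k n
      define E where "E = exp (- \<zeta>\<^sub>1 k * \<gamma>\<^sub>t\<^sub>h / \<mu>\<^sub>1)"
      define p where "p = (2 * pi) ^ (r - 1)"
      define N where "N = real (M - m + k + 1)"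
      \<comment> \<open>The scalar coefficients are compared over the reals and only then multiplied
        by the complex G-value.\<close>
      have real_eq: "real m * real (M choose m) * (w k * E * (\<xi>\<^sup>2 * A / 2 ^ r * (b n * (real r powr (\<alpha> + real n - 1) / p))))
        = real m * \<xi>\<^sup>2 * A / (2 ^ r * p) * real (M choose m) *
          (real ((m - 1) choose k) * E * ((- 1) ^ k * b n * real r powr (\<alpha> + real n - 1) / N))"
        unfolding w_def N_def[symmetric] by (simp add: mult_ac)
      show "of_real (real m * real (M choose m)) * (of_real (w k * exp (- \<zeta>\<^sub>1 k * \<gamma>\<^sub>t\<^sub>h / \<mu>\<^sub>1)) *
          (of_real (\<xi>\<^sup>2 * A / 2 ^ r) * (of_real (b n) *
            (of_real (real r powr (\<alpha> + real n - 1) / (2 * pi) ^ (r - 1)) * G k n)))) =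
        of_real (real m * \<xi>\<^sup>2 * A / (2 ^ r * (2 * pi) ^ (r - 1)) * real (M choose m)) *
        (of_real (real ((m - 1) choose k) * exp (- \<zeta>\<^sub>1 k * \<gamma>\<^sub>t\<^sub>h / \<mu>\<^sub>1) *
          ((- 1) ^ k * b n * real r powr (\<alpha> + real n - 1) / real (M - m + k + 1))) * G k n)"
        using arg_cong[OF real_eq, of "\<lambda>x. complex_of_real x * G k n"]
        unfolding E_def p_def N_def by (simp only: of_real_mult mult.assoc)
    qed
    finally show "complex_of_real (prob {\<omega> \<in> space P. \<gamma> \<omega> \<le> \<gamma>\<^sub>t\<^sub>h}) =
        1 - complex_of_real (real m * \<xi>\<^sup>2 * A / (2 ^ r * (2 * pi) ^ (r - 1)) * real (M choose m)) *
        (\<Sum>k<m. \<Sum>n=1..\<beta>. complex_of_real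
          (real ((m - 1) choose k) * exp (- \<zeta>\<^sub>1 k * \<gamma>\<^sub>t\<^sub>h / \<mu>\<^sub>1) *
            ((- 1) ^ k * b n * real r powr (\<alpha> + real n - 1) / real (M - m + k + 1))) *
          meijer_G (3 * r + 1) 0 (map complex_of_real \<tau>\<^sub>5) (map complex_of_real (\<tau>\<^sub>4 n))
            (complex_of_real (\<zeta>\<^sub>2 k * \<gamma>\<^sub>t\<^sub>h / (\<mu>\<^sub>1 * \<mu>\<^sub>r))))"
      unfolding G_def .
  qed
qed

end
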